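(* Let $n_1,n_2,n_3\in\mathbb{N}$ be such that $n_1<n_2<n_3$. Let $X_1,X_2,\ldots$ be mean zero random variables with finite variances. Suppose that $X_1,\ldots,X_{n_1}$; $X_{n_1+1},\ldots,X_{n_2}$; $X_{n_2+1},\ldots,X_{n_3}$; and $X_{n_3+1},X_{n_3+2},\ldots$ form four independent groups of i.i.d. random variables, where the distributions may differ among the four groups. Let $W=\sum_{i=1}^NX_i$, where $N$ is a Poisson random variable with parameter $\lambda$, independent of $\{X_i\}_{i=1}^\infty$, and let $$\begin{aligned}\sigma^2:=\mathrm{Var}(W)&=\sum_{i=1}^{n_1}\mathrm{Var}(X_1)P(N\ge i)+\sum_{i=n_1+1}^{n_2}\mathrm{Var}(X_{n_1+1})P(N\ge i)\\&\quad+\sum_{i=n_2+1}^{n_3}\mathrm{Var}(X_{n_2+1})P(N\ge i)+\sum_{i=n_3+1}^{\infty}\mathrm{Var}(X_{n_3+1})P(N\ge i).\end{aligned}$$ Then $$\begin{aligned}d_1\big(\mathcal{L}(W/\sigma),\mathcal{L}(Z)\big)&\le\frac1{\sigma^3}\sum_{i=1}^{n_1}\left(\mathbb{E}|X_1|^3+2\,\mathbb{E}X_1^2\,\mathbb{E}|X_1|\right)P(N\ge i)^2\\&\quad+\frac1{\sigma^3}\sum_{i=n_1+1}^{n_2}\left(\mathbb{E}|X_{n_1+1}|^3+2\,\mathbb{E}X_{n_1+1}^2\,\mathbb{E}|X_{n_1+1}|\right)P(N\ge i)^2\\&\quad+\frac1{\sigma^3}\sum_{i=n_2+1}^{n_3}\left(\mathbb{E}|X_{n_2+1}|^3+2\,\mathbb{E}X_{n_2+1}^2\,\mathbb{E}|X_{n_2+1}|\right)P(N\ge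 i)^2\\&\quad+\frac1{\sigma^3}\sum_{i=n_3+1}^{\infty}\left(\mathbb{E}|X_{n_3+1}|^3+2\,\mathbb{E}X_{n_3+1}^2\,\mathbb{E}|X_{n_3+1}|\right)P(N\ge i)^2\\&\quad+\frac{2\sqrt2}{\sqrt\pi}\Bigg(1-\sum_{i=1}^{n_1}\frac{\mathrm{Var}(X_1)}{\sigma^2}P(N\ge i)^2-\sum_{i=n_1+1}^{n_2}\frac{\mathrm{Var}(X_{n_1+1})}{\sigma^2}P(N\ge i)^2\\&\qquad\qquad-\sum_{i=n_2+1}^{n_3}\frac{\mathrm{Var}(X_{n_2+1})}{\sigma^2}P(N\ge i)^2-\sum_{i=n_3+1}^{\infty}\frac{\mathrm{Var}(X_{n_3+1})}{\sigma^2}P(N\ge i)^2\Bigg),\end{aligned}$$ where $Z$ is a standard normal random variable.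
   Context: $\mathcal{L}(X)$ denotes the distribution of $X$. The $L^1$ (Wasserstein) distance is $d_1(\mathcal{L}(X),\mathcal{L}(Y))=\int_{-\infty}^\infty|P(X\le t)-P(Y\le t)|\,dt=\sup_{h}|\mathbb{E}h(X)-\mathbb{E}h(Y)|$, the supremum being over all $h:\mathbb{R}\to\mathbb{R}$ with $|h(y)-h(x)|\le|y-x|$ for all $x,y$. It is presupposed that $\sigma^2>0$, so that the normalization makes sense. *)

theory Defs
  imports "HOL-Probability.Probability"
begin

text \<open>
  The \<open>L\<^sup>1\<close> (Wasserstein) distance between two laws on the real line, given by the integral of the
  absolute difference of their distribution functions. It takes values in \<^typ>\<open>ennreal\<close>, so that no
  integrability side condition is needed.
\<close>

definition wasserstein_dist :: "real measure \<Rightarrow> real measure \<Rightarrow> ennreal" where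
  "wasserstein_dist P Q = (\<integral>\<^sup>+ t. ennreal \<bar>cdf P t - cdf Q t\<bar> \<partial>lborel)"

text \<open>
  \<open>E|Y|\<^sup>3 + 2 E[Y\<^sup>2] E|Y|\<close> for a random variable \<open>Y\<close> with finite variance. Only the third absolute
  moment may be infinite. It is therefore a nonnegative integral: the Bochner integral would be
  \<open>0\<close> in that case.
\<close>

definition third_moment_term :: "'a measure \<Rightarrow> ('a \<Rightarrow> real) \<Rightarrow> ennreal" where
  "third_moment_term M Y =
     (\<integral>\<^sup>+ \<omega>. ennreal (\<bar>Y \<omega>\<bar> ^ 3) \<partial>M) +
     ennreal (2 * (\<integral>\<omega>. (Y \<omega>)\<^sup>2 \<partial>M) * (\<integral>\<omega>. \<bar>Y \<omega>\<bar> \<partial>M))"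

end

theory Submission
  imports Defs
begin

text \<open>
  Stein's method. For \<open>g\<close> continuous with values in \<open>[-1, 1]\<close>, let \<open>f\<close> solve
  \<open>f' w - w f w = \<integral> g(t) (\<Phi>(t) - 1\<^bsub>w \<le> t\<^esub>) dt\<close>, where \<open>\<Phi>\<close> is the standard normal
  distribution function. Integrating over the law \<open>P\<close> of the normalized sum turns the right-hand side
  into \<open>\<integral> g (\<Phi> - F\<^sub>P)\<close>, and \<open>g\<close> may approach the sign of \<open>\<Phi> - F\<^sub>P\<close>; so the distance is at most
  the supremum of \<open>E (f' W - W f W)\<close>, where \<open>\<bar>f'\<bar> \<le> \<surd>(2/\<pi>)\<close> and \<open>\<bar>f''\<bar> \<le> 2\<close>.
  Writing \<open>W = \<Sum>i. 1\<^bsub>i \<le> N\<^esub> X\<^sub>i\<close> with unit variance, one compares \<open>Var(X\<^sub>i) P(N \<ge> i) E f' W\<close> with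
  \<open>E (1\<^bsub>i \<le> N\<^esub> X\<^sub>i f W)\<close> for each \<open>i\<close>. On \<open>N \<ge> i\<close> a leave-one-out expansion bounds the difference
  by the third-moment term with weight \<open>P(N \<ge> i)\<^sup>2\<close>; what remains has weight \<open>P(N \<ge> i) (1 - P(N \<ge> i))\<close>
  and is bounded by \<open>2 \<surd>(2/\<pi>) Var(X\<^sub>i)\<close>.
\<close>

section \<open>The standard normal distribution function\<close>

text \<open>If \<open>h' = g\<close>, the right-hand side of the equation is
  \<open>h w - E h(Z)\<close>: it is the classical Stein equation for the Lipschitz test function
  \<open>h\<close>, with \<open>g\<close> kept as the datum because \<open>g\<close> pairs directly
  with a difference of distribution functions. Since \<open>f'' = f + w f' + g\<close>, a jump of
  \<open>g\<close> would destroy the second derivative there; hence the sign function enters only as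
  a limit of continuous functions.

  The delicate bound is the one on \<open>f'\<close>. It rests on a product inequality for the
  integrals of \<Phi> and of 1 - \<Phi>, extremal at \<open>w = 0\<close>, whose proof
  differentiates until the sign is evident.

  The bound 2 on \<open>f''\<close> is used twice: halved in a Taylor remainder it gives
  \<open>E|X|^3\<close>, and as the Lipschitz constant of \<open>f'\<close> it gives
  \<open>2 E X^2 E|X|\<close>.

  One factor \<open>P(N \<ge> i)\<close> of the square comes from the weight of index
  \<open>i\<close> in the variance, the other from the mass of the event on which the leave-one-out
  comparison is made. Off that event no cancellation is available, whence the second error
  term.\<close>

lemma integral_Icc_antiderivative:
  fixes g :: "real \<Rightarrow> real"
  assumes "continuous_on UNIV g"
  obtains G where "\<And>x. DERIV G x :> g x"
    and "\<And>a b. a \<le> b \<Longrightarrow> has_bochner_integral lborel (\<lambda>t. g t * indicator {a..b} t) (G b - G a)"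
proof -
  have cont: "isCont g x" for x
    using assms by (simp add: continuous_on_eq_continuous_at)
  obtain G where "\<And>x. (G has_vector_derivative g x) (at x)"
    using einterval_antiderivative[of "-\<infinity>" \<infinity> g] cont by auto
  then have G: "DERIV G x :> g x" for x
    by (simp add: has_real_derivative_iff_has_vector_derivative)
  show thesis
    by (rule that[of G]) (auto intro!: G cont has_bochner_integral_FTC_Icc_real)
qed

lemma DERIV_integral_atMost:
  fixes g :: "real \<Rightarrow> real"
  assumes cont: "continuous_on UNIV g"
    and int: "\<And>w. integrable lborel (\<lambda>t. g t * indicator {..w} t)"
  shows "DERIV (\<lambda>w. \<integral>t. g t * indicator {..w} t \<partial>lborel) w :> g w"
proof -
  obtain G where G: "\<And>x. DERIV G x :> g x"
    and G': "\<And>a b. a \<le> b \<Longrightarrow> has_bochner_integral lborel (\<lambda>t. g t * indicator {a..b} t) (G b - G a)"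
    using integral_Icc_antiderivative[OF cont] by blast
  define F where "F w = (\<integral>t. g t * indicator {..w} t \<partial>lborel)" for w
  \<comment> \<open>The part below \<open>w - 1\<close> is constant, so near \<open>w\<close> the
    improper integral differs from the antiderivative \<open>G\<close> by a constant. The two pieces
    overlap only in the null set {w - 1}.\<close>
  have *: "F x = F (w - 1) - G (w - 1) + G x" if "w - 1 < x" for x
  proof -
    have "F x = (\<integral>t. g t * indicator {..w-1} t + g t * indicator {w-1..x} t \<partial>lborel)"
      unfolding F_def
      by (rule integral_cong_AE)
         (use that borel_measurable_continuous_onI[OF cont] AE_lborel_singleton[of "w-1"]
          in \<open>auto elim!: eventually_mono split: split_indicator\<close>)
    also have "\<dots> = F (w - 1) + (G x - G (w - 1))"
      using G'[of "w-1" x] that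
      by (subst Bochner_Integration.integral_add) (auto simp: F_def int has_bochner_integral_iff)
    finally show ?thesis by simp
  qed
  have "DERIV (\<lambda>x. F (w - 1) - G (w - 1) + G x) w :> g w"
    by (auto intro!: derivative_eq_intros G)
  then have "DERIV F w :> g w"
    by (rule has_field_derivative_transform_within_open[where S="{w-1<..}"]) (auto simp: *)
  then show ?thesis by (simp add: F_def[abs_def])
qed

lemma DERIV_integral_atLeast:
  fixes g :: "real \<Rightarrow> real"
  assumes cont: "continuous_on UNIV g"
    and int: "\<And>w. integrable lborel (\<lambda>t. g t * indicator {w..} t)"
  shows "DERIV (\<lambda>w. \<integral>t. g t * indicator {w..} t \<partial>lborel) w :> - g w"
proof -
  have *: "(\<integral>t. g t * indicator {w..} t \<partial>lborel) = (\<integral>t. g (-t) * indicator {..-w} t \<partial>lborel)" for w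
    by (subst lborel_integral_real_affine[where c="-1" and t=0])
       (auto intro!: Bochner_Integration.integral_cong split: split_indicator)
  have "integrable lborel (\<lambda>t. g (-t) * indicator {..w} t)" for w
    using lborel_integrable_real_affine[OF int[of "-w"], of "-1" 0]
    by (rule Bochner_Integration.integrable_bound)
       (use borel_measurable_continuous_onI[OF cont] in \<open>auto split: split_indicator\<close>)
  from DERIV_integral_atMost[OF _ this, of "-w"]
  have "DERIV (\<lambda>w. \<integral>t. g (-t) * indicator {..w} t \<partial>lborel) (-w) :> g w"
    by (simp add: continuous_on_compose2[OF cont] continuous_intros)
  from DERIV_chain2[OF this DERIV_minus[OF DERIV_ident]]
  show ?thesis
    unfolding * by simp
qed

definition std_normal_cdf :: "real \<Rightarrow> real"
  where "std_normal_cdf = cdf std_normal_distribution"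

lemma std_normal_cdf_eq:
  "std_normal_cdf w = (\<integral>t. std_normal_density t * indicator {..w} t \<partial>lborel)"
proof -
  have "std_normal_cdf w = measure std_normal_distribution {..w}"
    by (simp add: std_normal_cdf_def cdf_def)
  also have "\<dots> = enn2real (\<integral>\<^sup>+t. std_normal_density t * indicator {..w} t \<partial>lborel)"
    by (simp add: measure_def emeasure_density ennreal_mult' ennreal_indicator)
  also have "\<dots> = (\<integral>t. std_normal_density t * indicator {..w} t \<partial>lborel)"
    by (rule integral_eq_nn_integral[symmetric]) auto
  finally show ?thesis .
qed

lemma DERIV_std_normal_cdf [derivative_intros]:
  assumes "(g has_real_derivative g') (at x within S)"
  shows "((\<lambda>x. std_normal_cdf (g x)) has_real_derivative std_normal_density (g x) * g') (at x within S)"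
proof -
  have "DERIV std_normal_cdf w :> std_normal_density w" for w
    unfolding std_normal_cdf_eq[abs_def]
  proof (rule DERIV_integral_atMost)
    show "continuous_on UNIV std_normal_density"
      unfolding std_normal_density_def by (intro continuous_intros) auto
  qed (auto intro!: integrable_real_mult_indicator)
  from DERIV_chain2[OF this assms] show ?thesis by simp
qed

lemma DERIV_std_normal_density [derivative_intros]:
  assumes "(g has_real_derivative g') (at x within S)"
  shows "((\<lambda>x. std_normal_density (g x)) has_real_derivative - g x * std_normal_density (g x) * g') (at x within S)"
  unfolding std_normal_density_def
  by (rule derivative_eq_intros assms refl | simp)+

lemma continuous_on_std_normal_cdf: "continuous_on S std_normal_cdf"
  using DERIV_isCont[OF DERIV_std_normal_cdf[OF DERIV_ident]]
  by (simp add: continuous_at_imp_continuous_on)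

lemma continuous_on_std_normal_density: "continuous_on S std_normal_density"
  using DERIV_isCont[OF DERIV_std_normal_density[OF DERIV_ident]]
  by (simp add: continuous_at_imp_continuous_on)

lemma borel_measurable_std_normal_cdf [measurable]: "std_normal_cdf \<in> borel_measurable borel"
  by (intro borel_measurable_continuous_onI continuous_on_std_normal_cdf)

interpretation std_normal: real_distribution std_normal_distribution
  by (rule real_dist_normal_dist)

lemma std_normal_density_pos: "std_normal_density x > 0"
  by (simp add: normal_density_pos)

lemma std_normal_density_minus: "std_normal_density (- x) = std_normal_density x"
  by (simp add: std_normal_density_def)

lemma std_normal_cdf_nonneg: "0 \<le> std_normal_cdf x"
  by (simp add: std_normal_cdf_def std_normal.cdf_nonneg)

lemma std_normal_cdf_le_1: "std_normal_cdf x \<le> 1"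
  by (simp add: std_normal_cdf_def std_normal.cdf_bounded_prob)

lemma tendsto_std_normal_cdf_at_top: "(std_normal_cdf \<longlongrightarrow> 1) at_top"
  by (simp add: std_normal_cdf_def std_normal.cdf_lim_at_top_prob)

lemma std_normal_cdf_minus: "std_normal_cdf (- x) = 1 - std_normal_cdf x"
proof -
  \<comment> \<open>Symmetry of the density makes this sum constant; its value is read off at
    infinity.\<close>
  have "DERIV (\<lambda>x. std_normal_cdf x + std_normal_cdf (- x)) x :> 0" for x
    by (auto intro!: derivative_eq_intros simp: std_normal_density_minus)
  then have const: "std_normal_cdf x + std_normal_cdf (- x) = std_normal_cdf y + std_normal_cdf (- y)" for x y
    using DERIV_isconst_all by blast
  have "((\<lambda>x. std_normal_cdf x + std_normal_cdf (- x)) \<longlongrightarrow> 1 + 0) at_top"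
    by (intro tendsto_add tendsto_std_normal_cdf_at_top filterlim_compose[OF std_normal.cdf_lim_at_bot
          filterlim_uminus_at_bot_at_top, folded std_normal_cdf_def])
  also have "(\<lambda>y. std_normal_cdf y + std_normal_cdf (- y)) = (\<lambda>y. std_normal_cdf x + std_normal_cdf (- x))"
    using const by blast
  finally have "((\<lambda>y::real. std_normal_cdf x + std_normal_cdf (- x)) \<longlongrightarrow> 1 + 0) at_top" .
  then show ?thesis
    by (simp add: tendsto_const_iff)
qed

section \<open>Tail bounds for the normal distribution function\<close>

lemma std_normal_density_tendsto_at_top:
  "((\<lambda>x. std_normal_density x) \<longlongrightarrow> 0) at_top"
  "((\<lambda>x. std_normal_density x / x) \<longlongrightarrow> 0) at_top"
  "((\<lambda>x. std_normal_density x * x / (1 + x\<^sup>2)) \<longlongrightarrow> 0) at_top"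
  unfolding std_normal_density_def by real_asymp+

text \<open>A nondecreasing function stays below its limit. This reduces each tail inequality below
  to the sign of one derivative, without estimating integrals.\<close>

lemma nonneg_deriv_tendsto_0_imp_nonpos:
  fixes f f' :: "real \<Rightarrow> real"
  assumes der: "\<And>x. x \<ge> a \<Longrightarrow> DERIV f x :> f' x" and nonneg: "\<And>x. x \<ge> a \<Longrightarrow> f' x \<ge> 0"
    and lim: "(f \<longlongrightarrow> 0) at_top"
  shows "f a \<le> 0"
proof (rule tendsto_lowerbound[OF lim])
  show "\<forall>\<^sub>F x in at_top. f a \<le> f x"
    using eventually_ge_at_top[of a]
  proof eventually_elim
    case (elim x)
    show ?case
      by (rule DERIV_nonneg_imp_nondecreasing[OF elim]) (use der nonneg in blast)
  qed
qed simp

lemma mills_upper: "w * (1 - std_normal_cdf w) \<le> std_normal_density w"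
proof (cases "w > 0")
  case True
  have "(1 - std_normal_cdf w) - std_normal_density w / w \<le> 0"
  proof (rule nonneg_deriv_tendsto_0_imp_nonpos[where a=w and
        f="\<lambda>w. (1 - std_normal_cdf w) - std_normal_density w / w"])
    show "DERIV (\<lambda>w. (1 - std_normal_cdf w) - std_normal_density w / w) x :> std_normal_density x / x\<^sup>2"
      if "x \<ge> w" for x
      using that True
      by (auto intro!: derivative_eq_intros)
         (simp add: divide_simps power2_eq_square)
    show "((\<lambda>w. 1 - std_normal_cdf w - std_normal_density w / w) \<longlongrightarrow> 0) at_top"
      using tendsto_diff[OF tendsto_diff[OF tendsto_const[of 1] tendsto_std_normal_cdf_at_top]
          std_normal_density_tendsto_at_top(2)] by simp
  qed (use True in auto)
  then show ?thesis using True by (simp add: field_simps)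
next
  case False
  then have "w * (1 - std_normal_cdf w) \<le> 0"
    using std_normal_cdf_le_1[of w] by (simp add: mult_nonpos_nonneg)
  then show ?thesis using std_normal_density_pos[of w] by linarith
qed

text \<open>After division by \<open>1 + w^2\<close>, which never vanishes, the difference of the
  two sides is monotone on the whole line, so no case split on the sign of \<open>w\<close> occurs.
  The bound on \<open>f''\<close> uses it at \<open>w\<close> and at \<open>- w\<close>.\<close>

lemma mills_lower: "w * std_normal_density w \<le> (1 + w\<^sup>2) * (1 - std_normal_cdf w)"
proof -
  have pos: "1 + x\<^sup>2 > 0" for x :: real
    by (simp add: add_pos_nonneg)
  have "std_normal_density w * w / (1 + w\<^sup>2) - (1 - std_normal_cdf w) \<le> 0"
  proof (rule nonneg_deriv_tendsto_0_imp_nonpos[where a=w and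
        f="\<lambda>w. std_normal_density w * w / (1 + w\<^sup>2) - (1 - std_normal_cdf w)"])
    show "DERIV (\<lambda>w. std_normal_density w * w / (1 + w\<^sup>2) - (1 - std_normal_cdf w)) x
        :> 2 * std_normal_density x / (1 + x\<^sup>2)\<^sup>2" for x
      using pos[of x]
      by (auto intro!: derivative_eq_intros)
         (simp add: divide_simps power2_eq_square, simp add: algebra_simps)
    show "((\<lambda>w. std_normal_density w * w / (1 + w\<^sup>2) - (1 - std_normal_cdf w)) \<longlongrightarrow> 0) at_top"
      using tendsto_diff[OF std_normal_density_tendsto_at_top(3) tendsto_diff[OF tendsto_const[of 1] 
        tendsto_std_normal_cdf_at_top]] by simp
  qed auto
  then show ?thesis using pos[of w] by (simp add: field_simps)
qed

section \<open>Solutions of Stein's equation\<close>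

lemma std_normal_cdf_0: "std_normal_cdf 0 = 1 / 2"
  using std_normal_cdf_minus[of 0] by simp

lemma std_normal_density_le_cdf:
  assumes "w \<ge> 0"
  shows "w * std_normal_density w \<le> 2 * std_normal_cdf w - 1"
proof -
  have "(2 * std_normal_cdf 0 - 1) - 0 * std_normal_density 0
      \<le> (2 * std_normal_cdf w - 1) - w * std_normal_density w"
  proof (rule DERIV_nonneg_imp_nondecreasing[OF assms], intro exI conjI)
    fix x :: real
    show "DERIV (\<lambda>w. (2 * std_normal_cdf w - 1) - w * std_normal_density w) x
        :> (1 + x\<^sup>2) * std_normal_density x"
      by (auto intro!: derivative_eq_intros simp: algebra_simps power2_eq_square)
  qed auto
  then show ?thesis by (simp add: std_normal_cdf_0)
qed

text \<open>This expression is the numerator of the derivative in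
  \<open>std_normal_cdf_variance_le\<close>. Its own derivative collapses to \<open>2 x\<close>
  times the gap in \<open>std_normal_density_le_cdf\<close>.\<close>

lemma std_normal_cdf_quadratic_ge:
  assumes "w \<ge> 0"
  shows "0 \<le> (2 * std_normal_cdf w - 1) * (w\<^sup>2 - 2) + 4 * w * std_normal_density w"
proof -
  have "(2 * std_normal_cdf 0 - 1) * (0\<^sup>2 - 2) + 4 * 0 * std_normal_density 0
      \<le> (2 * std_normal_cdf w - 1) * (w\<^sup>2 - 2) + 4 * w * std_normal_density w"
  proof (rule DERIV_nonneg_imp_nondecreasing[OF assms], intro exI conjI)
    fix x :: real assume "0 \<le> x"
    show "DERIV (\<lambda>w. (2 * std_normal_cdf w - 1) * (w\<^sup>2 - 2) + 4 * w * std_normal_density w) x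
        :> 2 * x * (2 * std_normal_cdf x - 1 - x * std_normal_density x)"
      by (auto intro!: derivative_eq_intros simp: algebra_simps power2_eq_square)
    show "0 \<le> 2 * x * (2 * std_normal_cdf x - 1 - x * std_normal_density x)"
      using std_normal_density_le_cdf[OF \<open>0 \<le> x\<close>] \<open>0 \<le> x\<close> by simp
  qed
  then show ?thesis by (simp add: std_normal_cdf_0)
qed

text \<open>The left side is the derivative of the quotient behind
  \<open>cdf_integrals_product_le\<close>, divided by
  \<open>w (2 + w^2) / std_normal_density w\<close>. This scaling gives the product \<Phi> (1 -
  \<Phi>) a constant coefficient, so differentiating once more leaves, up to a positive factor,
  something of degree one in \<Phi>.\<close>

lemma std_normal_cdf_variance_le:
  assumes "w > 0"
  shows "std_normal_density w * (2 * std_normal_cdf w - 1) * ((1 + w\<^sup>2) / (w * (2 + w\<^sup>2)))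
    + (std_normal_density w)\<^sup>2 / (2 + w\<^sup>2) - std_normal_cdf w * (1 - std_normal_cdf w) \<le> 0"
proof (rule nonneg_deriv_tendsto_0_imp_nonpos[where a=w and
      f="\<lambda>w. std_normal_density w * (2 * std_normal_cdf w - 1) * ((1 + w\<^sup>2) / (w * (2 + w\<^sup>2)))
        + (std_normal_density w)\<^sup>2 / (2 + w\<^sup>2) - std_normal_cdf w * (1 - std_normal_cdf w)"])
  fix x assume "w \<le> x"
  then have x: "x > 0" and "2 + x\<^sup>2 > 0" using assms by (auto simp: add_pos_nonneg)
  then show "DERIV (\<lambda>w. std_normal_density w * (2 * std_normal_cdf w - 1) * ((1 + w\<^sup>2) / (w * (2 + w\<^sup>2)))
        + (std_normal_density w)\<^sup>2 / (2 + w\<^sup>2) - std_normal_cdf w * (1 - std_normal_cdf w)) x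
      :> std_normal_density x * ((2 * std_normal_cdf x - 1) * (x\<^sup>2 - 2) + 4 * x * std_normal_density x)
          / (x\<^sup>2 * (2 + x\<^sup>2)\<^sup>2)"
    by (auto intro!: derivative_eq_intros)
       (simp add: divide_simps power2_eq_square, simp add: algebra_simps)
  show "0 \<le> std_normal_density x * ((2 * std_normal_cdf x - 1) * (x\<^sup>2 - 2) + 4 * x * std_normal_density x)
          / (x\<^sup>2 * (2 + x\<^sup>2)\<^sup>2)"
    using std_normal_cdf_quadratic_ge[of x] x by simp
next
  have "((\<lambda>w. std_normal_density w * ((1 + w\<^sup>2) / (w * (2 + w\<^sup>2)))) \<longlongrightarrow> 0) at_top"
    and 2: "((\<lambda>w. (std_normal_density w)\<^sup>2 / (2 + w\<^sup>2)) \<longlongrightarrow> 0) at_top"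
    unfolding std_normal_density_def by real_asymp+
  from tendsto_mult[OF this(1) tendsto_diff[OF tendsto_mult[OF tendsto_const[of 2] 
      tendsto_std_normal_cdf_at_top] tendsto_const[of 1]]]
  have 1: "((\<lambda>w. std_normal_density w * (2 * std_normal_cdf w - 1) * ((1 + w\<^sup>2) / (w * (2 + w\<^sup>2)))) \<longlongrightarrow> 0) at_top"
    by (simp add: ac_simps)
  show "((\<lambda>w. std_normal_density w * (2 * std_normal_cdf w - 1) * ((1 + w\<^sup>2) / (w * (2 + w\<^sup>2)))
        + (std_normal_density w)\<^sup>2 / (2 + w\<^sup>2) - std_normal_cdf w * (1 - std_normal_cdf w)) \<longlongrightarrow> 0) at_top"
    using tendsto_diff[OF tendsto_add[OF 1 2] tendsto_mult[OF tendsto_std_normal_cdf_at_top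
          tendsto_diff[OF tendsto_const[of 1] tendsto_std_normal_cdf_at_top]]] by simp
qed

text \<open>Closed form of the integral of \<Phi> up to \<open>w\<close>, that is of
  \<open>E max(0, w - Z)\<close>; the identity is \<open>has_bochner_integral_lower_cdf\<close>. The
  companion below is the integral of 1 - \<Phi> from \<open>w\<close> on, that is
  \<open>E max(0, Z - w)\<close>.\<close>

definition lower_cdf_integral :: "real \<Rightarrow> real"
  where "lower_cdf_integral w = w * std_normal_cdf w + std_normal_density w"

definition upper_cdf_integral :: "real \<Rightarrow> real"
  where "upper_cdf_integral w = std_normal_density w - w * (1 - std_normal_cdf w)"

lemma lower_cdf_integral_minus: "lower_cdf_integral (- w) = upper_cdf_integral w"
  by (simp add: lower_cdf_integral_def upper_cdf_integral_def std_normal_cdf_minus std_normal_density_minus)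

lemma upper_cdf_integral_nonneg: "0 \<le> upper_cdf_integral w"
  using mills_upper[of w] by (simp add: upper_cdf_integral_def)

lemma lower_cdf_integral_nonneg: "0 \<le> lower_cdf_integral w"
  using upper_cdf_integral_nonneg[of "- w"] by (simp add: lower_cdf_integral_minus[symmetric])

text \<open>
  The quotient of the two sides is even, and its derivative at \<open>w > 0\<close> is a positive multiple of the
  quantity bounded in \<open>std_normal_cdf_variance_le\<close>, so the quotient is largest at \<open>0\<close>.
\<close>

lemma cdf_integrals_product_le:
  "lower_cdf_integral w * upper_cdf_integral w \<le> std_normal_density w / sqrt (2 * pi)"
proof -
  have *: "lower_cdf_integral w * upper_cdf_integral w / std_normal_density w \<le> 1 / sqrt (2 * pi)"
    if "w \<ge> 0" for w
  proof -
    have "lower_cdf_integral w * upper_cdf_integral w / std_normal_density w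
        \<le> lower_cdf_integral 0 * upper_cdf_integral 0 / std_normal_density 0"
    proof (rule DERIV_nonpos_imp_decreasing_open[OF that])
      fix x :: real assume x: "0 < x"
      let ?N = "std_normal_density x * (2 * std_normal_cdf x - 1) * ((1 + x\<^sup>2) / (x * (2 + x\<^sup>2)))
        + (std_normal_density x)\<^sup>2 / (2 + x\<^sup>2) - std_normal_cdf x * (1 - std_normal_cdf x)"
      have "2 + x\<^sup>2 > 0" by (simp add: add_pos_nonneg)
      then have "DERIV (\<lambda>w. lower_cdf_integral w * upper_cdf_integral w / std_normal_density w) x
          :> x * (2 + x\<^sup>2) * ?N / std_normal_density x"
        unfolding lower_cdf_integral_def upper_cdf_integral_def
        using std_normal_density_pos[of x] x
        by (auto intro!: derivative_eq_intros)
           (simp add: divide_simps power2_eq_square, simp add: algebra_simps)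
      moreover have "x * (2 + x\<^sup>2) * ?N / std_normal_density x \<le> 0"
        using std_normal_cdf_variance_le[OF x] x std_normal_density_pos[of x]
        by (intro divide_nonpos_pos mult_nonneg_nonpos) auto
      ultimately show "\<exists>y. DERIV (\<lambda>w. lower_cdf_integral w * upper_cdf_integral w / std_normal_density w) x
          :> y \<and> y \<le> 0" by blast
    next
      show "continuous_on {0..w} (\<lambda>w. lower_cdf_integral w * upper_cdf_integral w / std_normal_density w)"
        unfolding lower_cdf_integral_def upper_cdf_integral_def
        by (intro continuous_intros continuous_on_std_normal_cdf continuous_on_std_normal_density)
           (simp add: less_imp_neq[OF std_normal_density_pos, symmetric])
    qed
    also have "\<dots> = 1 / sqrt (2 * pi)"
      by (simp add: lower_cdf_integral_def upper_cdf_integral_def std_normal_density_def)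
         (simp add: divide_simps)
    finally show ?thesis .
  qed
  have "lower_cdf_integral w * upper_cdf_integral w / std_normal_density w \<le> 1 / sqrt (2 * pi)"
    using *[of w] *[of "- w"] lower_cdf_integral_minus[of w] lower_cdf_integral_minus[of "- w"]
    by (cases "w \<ge> 0") (auto simp: std_normal_density_minus mult.commute)
  then show ?thesis
    using std_normal_density_pos[of w] by (simp add: field_simps)
qed

lemma has_bochner_integral_upper_cdf:
  "has_bochner_integral lborel (\<lambda>t. (1 - std_normal_cdf t) * indicator {w..} t) (upper_cdf_integral w)"
proof (rule has_bochner_integral_nn_integral)
  have lim0: "(upper_cdf_integral \<longlongrightarrow> 0) at_top"
  proof (rule tendsto_sandwich)
    show "\<forall>\<^sub>F x in at_top. upper_cdf_integral x \<le> std_normal_density x"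
      using eventually_ge_at_top[of 0]
      by eventually_elim (simp add: upper_cdf_integral_def std_normal_cdf_le_1)
  qed (auto simp: upper_cdf_integral_nonneg std_normal_density_tendsto_at_top)
  have "(\<integral>\<^sup>+t. ennreal (1 - std_normal_cdf t) * indicator {w..} t \<partial>lborel) = ennreal (0 - (- upper_cdf_integral w))"
  proof (rule nn_integral_FTC_atLeast)
    show "DERIV (\<lambda>x. - upper_cdf_integral x) x :> 1 - std_normal_cdf x" for x
      unfolding upper_cdf_integral_def by (auto intro!: derivative_eq_intros)
    show "((\<lambda>x. - upper_cdf_integral x) \<longlongrightarrow> 0) at_top"
      using tendsto_minus[OF lim0] by simp
  qed (auto simp: std_normal_cdf_le_1)
  then show "(\<integral>\<^sup>+t. ennreal ((1 - std_normal_cdf t) * indicator {w..} t) \<partial>lborel) = ennreal (upper_cdf_integral w)"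
    by (simp add: ennreal_mult'' ennreal_indicator)
qed (auto simp: upper_cdf_integral_nonneg std_normal_cdf_le_1)

lemma has_bochner_integral_lower_cdf:
  "has_bochner_integral lborel (\<lambda>t. std_normal_cdf t * indicator {..w} t) (lower_cdf_integral w)"
proof -
  have "has_bochner_integral lborel (\<lambda>t. (1 - std_normal_cdf (0 + (- 1) * t)) * indicator {-w..} (0 + (- 1) * t))
      (upper_cdf_integral (- w) /\<^sub>R \<bar>- 1\<bar>)"
    by (rule lborel_has_bochner_integral_real_affine_iff[THEN iffD1, OF _ has_bochner_integral_upper_cdf]) simp
  moreover have "upper_cdf_integral (- w) = lower_cdf_integral w"
    using lower_cdf_integral_minus[of "- w"] by simp
  moreover have "(\<lambda>t. (1 - std_normal_cdf (0 + (- 1) * t)) * indicator {-w..} (0 + (- 1) * t))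
      = (\<lambda>t. std_normal_cdf t * indicator {..w} t)"
    by (auto simp: std_normal_cdf_minus split: split_indicator)
  ultimately show ?thesis by simp
qed

text \<open>The half-line is closed so that, as a function of \<open>w\<close>, the indicator is
  that of \<open>{..t}\<close>, with mean exactly \<open>cdf M t\<close> for every
  \<open>t\<close>.\<close>

definition stein_kernel :: "real \<Rightarrow> real \<Rightarrow> real"
  where "stein_kernel w t = std_normal_cdf t - indicator {w..} t"

lemma has_bochner_integral_abs_stein_kernel:
  "has_bochner_integral lborel (\<lambda>t. \<bar>stein_kernel w t\<bar>) (lower_cdf_integral w + upper_cdf_integral w)"
proof -
  have "AE t in lborel. std_normal_cdf t * indicator {..w} t + (1 - std_normal_cdf t) * indicator {w..} t
      = \<bar>stein_kernel w t\<bar>"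
    using AE_lborel_singleton[of w] std_normal_cdf_nonneg std_normal_cdf_le_1
    by (auto elim!: eventually_mono simp: stein_kernel_def split: split_indicator)
  with has_bochner_integral_add[OF has_bochner_integral_lower_cdf[of w] has_bochner_integral_upper_cdf[of w]]
  show ?thesis
    by (subst has_bochner_integral_cong_AE[symmetric]) (auto simp: stein_kernel_def)
qed

text \<open>Multiplied by the density, \<open>f'\<close> and \<open>f'' - s\<close> are linear in
  the two one-sided integrals \<open>A\<close> and \<open>B\<close> of \<open>s\<close>. As these
  are bounded by \<open>lower_cdf_integral\<close> and \<open>upper_cdf_integral\<close>, both
  estimates become inequalities free of \<open>s\<close>.\<close>

lemma stein_solution:
  assumes cont: "continuous_on UNIV s" and s: "\<And>t. \<bar>s t\<bar> \<le> (1::real)"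
  obtains f f' f'' where
    "\<And>w. DERIV f w :> f' w" "\<And>w. DERIV f' w :> f'' w"
    "\<And>w. \<bar>f' w\<bar> \<le> 2 / sqrt (2 * pi)" "\<And>w. \<bar>f'' w\<bar> \<le> 2"
    "\<And>w. f' w - w * f w = (\<integral>t. s t * stein_kernel w t \<partial>lborel)"
proof -
  have [measurable]: "s \<in> borel_measurable borel"
    using cont by (rule borel_measurable_continuous_onI)
  define A where "A w = (\<integral>t. s t * std_normal_cdf t * indicator {..w} t \<partial>lborel)" for w
  define B where "B w = (\<integral>t. s t * (1 - std_normal_cdf t) * indicator {w..} t \<partial>lborel)" for w
  note A' = has_bochner_integral_lower_cdf[unfolded has_bochner_integral_iff]
  note B' = has_bochner_integral_upper_cdf[unfolded has_bochner_integral_iff]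
  have le_A: "\<bar>s t * std_normal_cdf t * indicator {..w} t\<bar> \<le> std_normal_cdf t * indicator {..w} t" for t w
    using s[of t] std_normal_cdf_nonneg[of t]
    by (auto simp: abs_mult mult_left_le_one_le split: split_indicator)
  have le_B: "\<bar>s t * (1 - std_normal_cdf t) * indicator {w..} t\<bar> \<le> (1 - std_normal_cdf t) * indicator {w..} t" for t w
    using s[of t] std_normal_cdf_le_1[of t]
    by (auto simp: abs_mult mult_left_le_one_le split: split_indicator)
  have int_A: "integrable lborel (\<lambda>t. s t * std_normal_cdf t * indicator {..w} t)" for w
    by (rule Bochner_Integration.integrable_bound[OF A'[THEN conjunct1, of w]])
       (use le_A in \<open>auto intro: order_trans[OF _ abs_ge_self]\<close>)
  have int_B: "integrable lborel (\<lambda>t. s t * (1 - std_normal_cdf t) * indicator {w..} t)" for w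
    by (rule Bochner_Integration.integrable_bound[OF B'[THEN conjunct1, of w]])
       (use le_B in \<open>auto intro: order_trans[OF _ abs_ge_self]\<close>)
  have abs_A: "\<bar>A w\<bar> \<le> lower_cdf_integral w" for w
    unfolding A_def A'[THEN conjunct2, of w, symmetric]
    using int_A A' le_A by (intro integral_abs_bound_integral) auto
  have abs_B: "\<bar>B w\<bar> \<le> upper_cdf_integral w" for w
    unfolding B_def B'[THEN conjunct2, of w, symmetric]
    using int_B B' le_B by (intro integral_abs_bound_integral) auto
  have DA: "DERIV A w :> s w * std_normal_cdf w" for w
    unfolding A_def
    by (rule DERIV_integral_atMost) (auto intro!: continuous_intros cont continuous_on_std_normal_cdf int_A)
  have DB: "DERIV B w :> - (s w * (1 - std_normal_cdf w))" for w
    unfolding B_def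
    by (rule DERIV_integral_atLeast) (auto intro!: continuous_intros cont continuous_on_std_normal_cdf int_B)
  have AB: "A w - B w = (\<integral>t. s t * stein_kernel w t \<partial>lborel)" for w
  proof -
    have "A w - B w = (\<integral>t. s t * std_normal_cdf t * indicator {..w} t
        - s t * (1 - std_normal_cdf t) * indicator {w..} t \<partial>lborel)"
      unfolding A_def B_def using int_A int_B by simp
    also have "\<dots> = (\<integral>t. s t * stein_kernel w t \<partial>lborel)"
      by (rule integral_cong_AE)
         (use AE_lborel_singleton[of w] in \<open>auto simp: stein_kernel_def algebra_simps elim!: eventually_mono split: split_indicator\<close>)
    finally show ?thesis .
  qed
  \<comment> \<open>In the derivative of the numerator the contributions of \<open>A'\<close> and
    \<open>B'\<close> cancel, so \<open>f'\<close> depends on \<open>s\<close> only through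
    \<open>A\<close> and \<open>B\<close> and can be differentiated again when \<open>s\<close> is
    merely continuous.\<close>
  define f where "f w = - ((1 - std_normal_cdf w) * A w + std_normal_cdf w * B w) / std_normal_density w" for w
  define f1 where "f1 w = w * f w + (A w - B w)" for w
  define f2 where "f2 w = f w + w * f1 w + s w" for w
  note pos = std_normal_density_pos
  have Df: "DERIV f w :> f1 w" for w
    unfolding f_def f1_def using pos[of w]
    by (auto intro!: derivative_eq_intros DA DB)
       (simp add: divide_simps, simp add: algebra_simps)
  have Df1: "DERIV f1 w :> f2 w" for w
    unfolding f1_def[abs_def] f2_def
    by (auto intro!: derivative_eq_intros DA DB Df) (simp add: f1_def algebra_simps)
  have f1_eq: "std_normal_density w * f1 w = A w * upper_cdf_integral w - B w * lower_cdf_integral w" for w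
    unfolding f1_def f_def lower_cdf_integral_def upper_cdf_integral_def using pos[of w]
    by (simp add: field_simps)
  have f2_eq: "std_normal_density w * (f2 w - s w) = 
      A w * (w * upper_cdf_integral w - (1 - std_normal_cdf w)) - B w * (std_normal_cdf w + w * lower_cdf_integral w)" for w
  proof -
    have "std_normal_density w * (f2 w - s w) = std_normal_density w * f w + w * (std_normal_density w * f1 w)"
      by (simp add: f2_def algebra_simps)
    also have "std_normal_density w * f w = - ((1 - std_normal_cdf w) * A w + std_normal_cdf w * B w)"
      using pos[of w] by (simp add: f_def)
    finally show ?thesis unfolding f1_eq by (simp add: algebra_simps)
  qed
  have "\<bar>f1 w\<bar> \<le> 2 / sqrt (2 * pi)" for w
  proof -
    have "std_normal_density w * \<bar>f1 w\<bar> = \<bar>std_normal_density w * f1 w\<bar>"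
      using pos[of w] by (simp add: abs_mult)
    also have "\<dots> \<le> \<bar>A w\<bar> * upper_cdf_integral w + \<bar>B w\<bar> * lower_cdf_integral w"
      unfolding f1_eq using lower_cdf_integral_nonneg[of w] upper_cdf_integral_nonneg[of w]
      by (intro order_trans[OF abs_triangle_ineq4]) (simp add: abs_mult)
    also have "\<dots> \<le> lower_cdf_integral w * upper_cdf_integral w + upper_cdf_integral w * lower_cdf_integral w"
      using lower_cdf_integral_nonneg[of w] upper_cdf_integral_nonneg[of w] abs_A abs_B
      by (intro add_mono mult_right_mono) auto
    also have "\<dots> \<le> std_normal_density w * (2 / sqrt (2 * pi))"
      using cdf_integrals_product_le[of w] by (simp add: mult.commute)
    finally show ?thesis using pos[of w] by (rule mult_left_le_imp_le)
  qed
  moreover have "\<bar>f2 w\<bar> \<le> 2" for w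
  proof -
    \<comment> \<open>Mills' lower bound at \<open>w\<close> and at \<open>- w\<close> fixes the
      signs of the coefficients of \<open>A\<close> and \<open>B\<close>, so their absolute values
      are explicit.\<close>
    have 1: "w * upper_cdf_integral w - (1 - std_normal_cdf w) \<le> 0"
      using mills_lower[of w] by (simp add: upper_cdf_integral_def algebra_simps power2_eq_square)
    have 2: "0 \<le> std_normal_cdf w + w * lower_cdf_integral w"
      using mills_lower[of "- w"]
      by (simp add: lower_cdf_integral_def std_normal_cdf_minus std_normal_density_minus algebra_simps power2_eq_square)
    have "std_normal_density w * \<bar>f2 w - s w\<bar> = \<bar>std_normal_density w * (f2 w - s w)\<bar>"
      using pos[of w] by (simp add: abs_mult)
    also have "\<dots> \<le> \<bar>A w\<bar> * ((1 - std_normal_cdf w) - w * upper_cdf_integral w)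
        + \<bar>B w\<bar> * (std_normal_cdf w + w * lower_cdf_integral w)"
      unfolding f2_eq using 1 2
      by (intro order_trans[OF abs_triangle_ineq4]) (simp add: abs_mult)
    also have "\<dots> \<le> lower_cdf_integral w * ((1 - std_normal_cdf w) - w * upper_cdf_integral w)
        + upper_cdf_integral w * (std_normal_cdf w + w * lower_cdf_integral w)"
      using 1 2 abs_A abs_B by (intro add_mono mult_right_mono) auto
    \<comment> \<open>The products of the two integrals cancel; what remains is
      \<open>lower_cdf_integral w * (1 - std_normal_cdf w) + upper_cdf_integral w * std_normal_cdf
      w\<close>, where the terms with a factor \<open>w\<close> cancel too.\<close>
    also have "\<dots> = std_normal_density w"
      by (simp add: lower_cdf_integral_def upper_cdf_integral_def algebra_simps)
    finally have "\<bar>f2 w - s w\<bar> \<le> 1" using pos[of w] by simp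
    then show ?thesis using s[of w] by linarith
  qed
  moreover have "f1 w - w * f w = (\<integral>t. s t * stein_kernel w t \<partial>lborel)" for w
    by (simp add: f1_def AB)
  ultimately show thesis using that Df Df1 by blast
qed

section \<open>Wasserstein distance and Stein's equation\<close>

lemma tendsto_clip_sgn:
  fixes a :: "nat \<Rightarrow> real"
  assumes "a \<longlonglongrightarrow> l" "l \<noteq> 0"
  shows "(\<lambda>k. max (-1) (min 1 (real k * a k))) \<longlonglongrightarrow> sgn l"
proof -
  show ?thesis
  proof (cases "l > 0")
    case True
    have "filterlim (\<lambda>k. a k * real k) at_top sequentially"
      by (rule filterlim_tendsto_pos_mult_at_top[OF assms(1) True filterlim_real_sequentially])
    then have "\<forall>\<^sub>F k in sequentially. 1 \<le> a k * real k"
      by (simp add: filterlim_at_top)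
    then have "\<forall>\<^sub>F k in sequentially. max (-1) (min 1 (real k * a k)) = sgn l"
      by eventually_elim (use True in \<open>simp add: mult.commute\<close>)
    then show ?thesis by (rule tendsto_eventually)
  next
    case False
    have "filterlim (\<lambda>k. a k * real k) at_bot sequentially"
      by (rule filterlim_tendsto_neg_mult_at_bot[OF assms(1) _ filterlim_real_sequentially])
         (use False assms(2) in auto)
    then have "\<forall>\<^sub>F k in sequentially. a k * real k \<le> -1"
      by (simp add: filterlim_at_bot)
    then have "\<forall>\<^sub>F k in sequentially. max (-1) (min 1 (real k * a k)) = sgn l"
      by eventually_elim (use False assms(2) in \<open>simp add: mult.commute\<close>)
    then show ?thesis by (rule tendsto_eventually)
  qed
qed

lemma ramp_tendsto_indicator:
  "(\<lambda>k. max 0 (min 1 (1 + real k * (t - x)))) \<longlonglongrightarrow> (indicator {..t} x :: real)"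
proof (cases "x \<le> t")
  case True
  then have "max 0 (min 1 (1 + real k * (t - x))) = 1" for k by (simp add: min_absorb1)
  then show ?thesis using True by simp
next
  case False
  have "filterlim (\<lambda>k. (t - x) * real k) at_bot sequentially"
    by (rule filterlim_tendsto_neg_mult_at_bot[OF tendsto_const _ filterlim_real_sequentially])
       (use False in auto)
  then have "\<forall>\<^sub>F k in sequentially. (t - x) * real k \<le> -1"
    by (simp add: filterlim_at_bot)
  then have "\<forall>\<^sub>F k in sequentially. max 0 (min 1 (1 + real k * (t - x))) = indicator {..t} x"
    by eventually_elim (use False in \<open>simp add: mult.commute\<close>)
  then show ?thesis by (rule tendsto_eventually)
qed

text \<open>
  \<open>s k\<close> is \<open>k * (G - F k)\<close> truncated to \<open>[-1, 1]\<close>, where \<open>F k\<close> is the distribution function made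
  continuous by replacing indicators of half-lines with ramps of slope \<open>k\<close>.
\<close>

lemma (in real_distribution) continuous_approx_sgn_cdf_diff:
  assumes G: "continuous_on UNIV G"
  obtains s :: "nat \<Rightarrow> real \<Rightarrow> real" where "\<And>k. continuous_on UNIV (s k)" "\<And>k t. \<bar>s k t\<bar> \<le> 1"
    "\<And>t. (\<lambda>k. s k t * (G t - cdf M t)) \<longlonglongrightarrow> \<bar>G t - cdf M t\<bar>"
proof -
  define F where "F k t = (\<integral>x. max 0 (min 1 (1 + real k * (t - x))) \<partial>M)" for k t
  have lim: "(\<lambda>k. F k t) \<longlonglongrightarrow> cdf M t" for t
  proof -
    have "(\<lambda>k. F k t) \<longlonglongrightarrow> (\<integral>x. indicator {..t} x \<partial>M)"
      unfolding F_def
      by (rule integral_dominated_convergence[where w="\<lambda>_. 1"]) (auto intro: ramp_tendsto_indicator)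
    then show ?thesis by (simp add: cdf_def)
  qed
  have cont: "continuous_on UNIV (F k)" for k
    unfolding continuous_on_sequentially comp_def
  proof (intro allI ballI impI, elim conjE)
    fix u :: "nat \<Rightarrow> real" and a assume u: "u \<longlonglongrightarrow> a"
    show "(\<lambda>n. F k (u n)) \<longlonglongrightarrow> F k a"
      unfolding F_def
      by (rule integral_dominated_convergence[where w="\<lambda>_. 1"]) (auto intro!: tendsto_intros u)
  qed
  define s where "s k t = max (-1) (min 1 (real k * (G t - F k t)))" for k t
  show thesis
  proof (rule that[of s])
    show "continuous_on UNIV (s k)" for k
      unfolding s_def by (intro continuous_intros cont G)
    show "\<bar>s k t\<bar> \<le> 1" for k t
      by (auto simp: s_def)
    show "(\<lambda>k. s k t * (G t - cdf M t)) \<longlonglongrightarrow> \<bar>G t - cdf M t\<bar>" for t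
    \<comment> \<open>Where the difference vanishes, \<open>s k t\<close> may fail to converge, but
      the product is 0 for every \<open>k\<close>.\<close>
    proof (cases "G t - cdf M t = 0")
      case False
      have "(\<lambda>k. s k t * (G t - cdf M t)) \<longlonglongrightarrow> sgn (G t - cdf M t) * (G t - cdf M t)"
        unfolding s_def using False
        by (intro tendsto_intros tendsto_clip_sgn lim)
      then show ?thesis by (simp add: abs_sgn mult.commute)
    qed simp
  qed
qed

lemma measurable_stein_kernel [measurable]:
  "(\<lambda>x. stein_kernel (fst x) (snd x)) \<in> borel_measurable (borel \<Otimes>\<^sub>M borel)"
  unfolding stein_kernel_def indicator_def atLeast_iff by measurable

text \<open>Fubini for the law and Lebesgue measure. The integral of the absolute kernel over
  \<open>t\<close> is \<open>2 \<phi>(x) + x (2 \<Phi>(x) - 1)\<close>, at most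
  \<open>1 + |x|\<close>, so a first moment suffices for integrability on the product.\<close>

lemma (in real_distribution) stein_kernel_integral:
  assumes int: "integrable M (\<lambda>x. x)"
    and s [measurable]: "s \<in> borel_measurable borel" and s_le: "\<And>t. \<bar>s t\<bar> \<le> 1"
  shows "integrable lborel (\<lambda>t. s t * (std_normal_cdf t - cdf M t))"
    and "(\<integral>t. s t * (std_normal_cdf t - cdf M t) \<partial>lborel)
      = (\<integral>x. (\<integral>t. s t * stein_kernel x t \<partial>lborel) \<partial>M)"
proof -
  interpret P: pair_sigma_finite M lborel ..
  let ?g = "\<lambda>(x, t). s t * stein_kernel x t"
  have sets_eq: "sets (M \<Otimes>\<^sub>M lborel) = sets (borel \<Otimes>\<^sub>M borel)"
    by (intro sets_pair_measure_cong) auto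
  have [measurable]: "?g \<in> borel_measurable (M \<Otimes>\<^sub>M lborel)"
    unfolding measurable_cong_sets[OF sets_eq refl] by (simp add: case_prod_beta)
  have le: "norm (s t * stein_kernel x t) \<le> \<bar>stein_kernel x t\<bar>" for x t
    using s_le[of t] by (simp add: abs_mult mult_left_le_one_le)
  note K = has_bochner_integral_abs_stein_kernel[unfolded has_bochner_integral_iff]
  have int_x: "integrable lborel (\<lambda>t. s t * stein_kernel x t)" for x
    by (rule Bochner_Integration.integrable_bound[OF K[THEN conjunct1, of x]])
       (use le in \<open>auto simp: stein_kernel_def\<close>)
  have int_g: "integrable (M \<Otimes>\<^sub>M lborel) ?g"
  proof (rule P.Fubini_integrable)
    have "integrable M (\<lambda>x. 1 + \<bar>x\<bar>)" using int by auto
    then show "integrable M (\<lambda>x. \<integral>t. norm (?g (x, t)) \<partial>lborel)"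
    proof (rule Bochner_Integration.integrable_bound)
      show "AE x in M. norm (\<integral>t. norm (?g (x, t)) \<partial>lborel) \<le> norm (1 + \<bar>x\<bar>)"
      proof (rule AE_I2)
        fix x
        have "(\<integral>t. norm (?g (x, t)) \<partial>lborel) \<le> (\<integral>t. \<bar>stein_kernel x t\<bar> \<partial>lborel)"
          using le K int_x by (intro integral_mono) auto
        also have "\<dots> = 2 * std_normal_density x + x * (2 * std_normal_cdf x - 1)"
          using K by (simp add: lower_cdf_integral_def upper_cdf_integral_def algebra_simps)
        also have "x * (2 * std_normal_cdf x - 1) \<le> \<bar>x\<bar> * \<bar>2 * std_normal_cdf x - 1\<bar>"
          by (metis abs_ge_self abs_mult)
        also have "\<dots> \<le> \<bar>x\<bar> * 1"
          using std_normal_cdf_nonneg[of x] std_normal_cdf_le_1[of x] by (intro mult_left_mono) auto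
        also have "2 * std_normal_density x \<le> 1"
        proof -
          have "2 \<le> sqrt (2 * pi)" using pi_gt3 by (intro real_le_rsqrt) auto
          moreover have "exp (- x\<^sup>2 / 2) \<le> 1" by simp
          ultimately show ?thesis by (simp add: std_normal_density_def divide_simps order_trans[OF mult_left_mono[of _ 1 2]])
        qed
        finally show "norm (\<integral>t. norm (?g (x, t)) \<partial>lborel) \<le> norm (1 + \<bar>x\<bar>)" by simp
      qed
    qed measurable
    show "AE x in M. integrable lborel (\<lambda>t. ?g (x, t))" using int_x by simp
  qed simp
  have cdf: "(\<integral>x. stein_kernel x t \<partial>M) = std_normal_cdf t - cdf M t" for t
  proof -
    have *: "stein_kernel x t = std_normal_cdf t - indicator {..t} x" for x
      by (simp add: stein_kernel_def indicator_def)
    have "integrable M (indicator {..t} :: real \<Rightarrow> real)"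
      by (intro integrable_const_bound[where B=1]) auto
    then show ?thesis
      using prob_space by (simp add: * cdf_def del: integral_indicator integrable_indicator_iff)
  qed
  show "integrable lborel (\<lambda>t. s t * (std_normal_cdf t - cdf M t))"
    using P.integrable_snd[OF int_g] by (simp add: cdf)
  show "(\<integral>t. s t * (std_normal_cdf t - cdf M t) \<partial>lborel) = (\<integral>x. (\<integral>t. s t * stein_kernel x t \<partial>lborel) \<partial>M)"
    using P.Fubini_integral[OF int_g] by (simp add: cdf)
qed

lemma (in real_distribution) wasserstein_dist_std_normal_le:
  assumes int: "integrable M (\<lambda>x. x)"
    and stein: "\<And>f f' f''. \<lbrakk>\<And>w. DERIV f w :> f' w; \<And>w. DERIV f' w :> f'' w;
      \<And>w. \<bar>f' w\<bar> \<le> 2 / sqrt (2 * pi); \<And>w. \<bar>f'' w\<bar> \<le> 2\<rbrakk> \<Longrightarrow> (\<integral>x. f' x - x * f x \<partial>M) \<le> C"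
  shows "wasserstein_dist M std_normal_distribution \<le> ennreal C"
proof -
  obtain s :: "nat \<Rightarrow> real \<Rightarrow> real" where s: "\<And>k. continuous_on UNIV (s k)" "\<And>k t. \<bar>s k t\<bar> \<le> 1"
    "\<And>t. (\<lambda>k. s k t * (std_normal_cdf t - cdf M t)) \<longlonglongrightarrow> \<bar>std_normal_cdf t - cdf M t\<bar>"
    using continuous_approx_sgn_cdf_diff[OF continuous_on_std_normal_cdf] by blast
  have [measurable]: "s k \<in> borel_measurable borel" for k
    using s(1) by (rule borel_measurable_continuous_onI)
  have bound: "(\<integral>t. s k t * (std_normal_cdf t - cdf M t) \<partial>lborel) \<le> C" for k
  proof -
    obtain f f' f'' where f: "\<And>w. DERIV f w :> f' w" "\<And>w. DERIV f' w :> f'' w"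
      "\<And>w. \<bar>f' w\<bar> \<le> 2 / sqrt (2 * pi)" "\<And>w. \<bar>f'' w\<bar> \<le> 2"
      "\<And>w. f' w - w * f w = (\<integral>t. s k t * stein_kernel w t \<partial>lborel)"
      using stein_solution[OF s(1,2)] by blast
    have "(\<integral>t. s k t * (std_normal_cdf t - cdf M t) \<partial>lborel) = (\<integral>x. f' x - x * f x \<partial>M)"
      by (simp add: stein_kernel_integral(2)[OF int _ s(2)] f(5))
    also have "\<dots> \<le> C" by (rule stein[OF f(1-4)])
    finally show ?thesis .
  qed
  \<comment> \<open>The choice \<open>s = 1\<close> shows that the distance is finite; the same
    function then dominates the limit in \<open>k\<close>.\<close>
  have diff: "integrable lborel (\<lambda>t. \<bar>std_normal_cdf t - cdf M t\<bar>)"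
    using stein_kernel_integral(1)[OF int, of "\<lambda>_. 1"] by auto
  have [measurable]: "(\<lambda>t. std_normal_cdf t - cdf M t) \<in> borel_measurable borel"
    using stein_kernel_integral(1)[OF int, of "\<lambda>_. 1"] by auto
  have "(\<lambda>k. \<integral>t. s k t * (std_normal_cdf t - cdf M t) \<partial>lborel) \<longlonglongrightarrow> (\<integral>t. \<bar>std_normal_cdf t - cdf M t\<bar> \<partial>lborel)"
    by (rule integral_dominated_convergence[OF _ _ diff])
       (use s in \<open>auto simp: abs_mult mult_left_le_one_le\<close>)
  then have "(\<integral>t. \<bar>std_normal_cdf t - cdf M t\<bar> \<partial>lborel) \<le> C"
    by (rule LIMSEQ_le_const2) (use bound in auto)
  moreover have "wasserstein_dist M std_normal_distribution = ennreal (\<integral>t. \<bar>std_normal_cdf t - cdf M t\<bar> \<partial>lborel)"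
    unfolding wasserstein_dist_def std_normal_cdf_def[symmetric]
    by (subst nn_integral_eq_integral[symmetric, OF diff]) (auto simp: abs_minus_commute)
  ultimately show ?thesis by (simp add: ennreal_leI)
qed

section \<open>Weighted sums over a random index\<close>

lemma has_sum_diff:
  fixes f g :: "'b \<Rightarrow> real"
  assumes "(f has_sum a) A" "(g has_sum b) A"
  shows "((\<lambda>x. f x - g x) has_sum (a - b)) A"
  using has_sum_add[OF assms(1) has_sum_uminusI[OF assms(2)]] by simp

text \<open>Fubini on the triangle \<open>1 \<le> i \<le> n\<close>. The nonnegative weights
  \<open>v\<close> dominate \<open>g\<close> and give absolute summability; \<open>total\<close>
  identifies the value of the double sum, which is then read by columns.\<close>

lemma has_sum_triangle_swap:
  fixes q v :: "nat \<Rightarrow> real" and g :: "nat \<Rightarrow> nat \<Rightarrow> real"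
  assumes q: "\<And>n. 0 \<le> q n" and v: "\<And>i. 1 \<le> i \<Longrightarrow> 0 \<le> v i"
    and summ: "(\<lambda>n. q n * (\<Sum>i=1..n. v i)) summable_on UNIV"
    and le: "\<And>n i. 1 \<le> i \<Longrightarrow> i \<le> n \<Longrightarrow> \<bar>g n i\<bar> \<le> C * v i"
    and total: "((\<lambda>n. q n * (\<Sum>i=1..n. g n i)) has_sum S) UNIV"
  shows "((\<lambda>i. \<Sum>\<^sub>\<infinity>n\<in>{i..}. q n * g n i) has_sum S) {1..}"
proof -
  let ?T = "SIGMA n:UNIV. {1..n::nat}"
  have "(\<lambda>(n, i). q n * v i) summable_on ?T"
  proof (rule summable_on_SigmaI)
    show "((\<lambda>i. case (n, i) of (n, i) \<Rightarrow> q n * v i) has_sum (q n * (\<Sum>i=1..n. v i))) {1..n}" for n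
      by (simp add: has_sum_finite_iff sum_distrib_left)
  qed (use q v summ in auto)
  from summable_on_cmult_right[OF this, of C]
  have "(\<lambda>x. C * (case x of (n, i) \<Rightarrow> q n * v i)) summable_on ?T" .
  then have "(\<lambda>x. norm (case x of (n, i) \<Rightarrow> q n * g n i)) summable_on ?T"
  proof (rule Infinite_Sum.abs_summable_on_comparison_test')
    fix x assume "x \<in> ?T"
    then show "norm (case x of (n, i) \<Rightarrow> q n * g n i) \<le> C * (case x of (n, i) \<Rightarrow> q n * v i)"
      using mult_left_mono[OF le[of "snd x" "fst x"] q[of "fst x"]] q[of "fst x"]
      by (auto simp: abs_mult ac_simps)
  qed
  then have summ_T: "(\<lambda>(n, i). q n * g n i) summable_on ?T"
    by (rule abs_summable_summable)
  then obtain S' where S': "((\<lambda>(n, i). q n * g n i) has_sum S') ?T"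
    by (auto simp: summable_on_def)
  have "((\<lambda>n. q n * (\<Sum>i=1..n. g n i)) has_sum S') UNIV"
    by (rule has_sum_SigmaD[OF S']) (simp add: has_sum_finite_iff sum_distrib_left)
  then have "S' = S" using total by (rule has_sum_unique)
  have bij: "bij_betw prod.swap (SIGMA i:{1..}. {i..}) ?T"
    by (rule bij_betwI[where g=prod.swap]) auto
  have swap: "((\<lambda>(i, n). q n * g n i) has_sum S) (SIGMA i:{1..}. {i..})"
    using S' has_sum_reindex_bij_betw[OF bij, of "\<lambda>(n, i). q n * g n i" S']
    by (simp add: \<open>S' = S\<close> case_prod_unfold)
  show ?thesis
  proof (rule has_sum_SigmaD[OF swap])
    fix i :: nat assume "i \<in> {1..}"
    then have "(\<lambda>n. q n * g n i) summable_on {i..}"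
      by (rule summable_on_SigmaD1[OF has_sum_imp_summable[OF swap]])
    then show "((\<lambda>n. case (i, n) of (i, n) \<Rightarrow> q n * g n i) has_sum (\<Sum>\<^sub>\<infinity>n\<in>{i..}. q n * g n i)) {i..}"
      by simp
  qed
qed

text \<open>
  The index \<open>n\<close> is random with weights \<open>q n\<close> and tail \<open>p i\<close>. Splitting the mean of \<open>a\<close> at \<open>n < i\<close>
  and \<open>n \<ge> i\<close> produces one factor \<open>1 - p i\<close> for each of the two terms that can only be bounded
  crudely, and a factor \<open>(p i)\<^sup>2\<close> for the term where \<open>v i * a n\<close> is close to \<open>b n i\<close>.
\<close>

lemma random_index_bound:
  fixes q a v \<tau> p :: "nat \<Rightarrow> real" and b :: "nat \<Rightarrow> nat \<Rightarrow> real"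
  assumes q: "\<And>n. 0 \<le> q n" and q_sum: "(q has_sum 1) UNIV"
    and p: "\<And>i. (q has_sum p i) {i..}"
    and v: "\<And>i. 1 \<le> i \<Longrightarrow> 0 \<le> v i"
    and vp: "((\<lambda>i. v i * p i) has_sum 1) {1..}"
    and summ: "(\<lambda>n. q n * (\<Sum>i=1..n. v i)) summable_on UNIV"
    and a: "\<And>n. \<bar>a n\<bar> \<le> c"
    and b: "\<And>n i. 1 \<le> i \<Longrightarrow> i \<le> n \<Longrightarrow> \<bar>b n i\<bar> \<le> c * v i"
    and ab: "\<And>n i. 1 \<le> i \<Longrightarrow> i \<le> n \<Longrightarrow> \<bar>v i * a n - b n i\<bar> \<le> \<tau> i"
    and \<tau>: "(\<lambda>i. \<tau> i * (p i)\<^sup>2) summable_on {1..}"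
    and A: "((\<lambda>n. q n * a n) has_sum A) UNIV"
    and B: "((\<lambda>n. q n * (\<Sum>i=1..n. b n i)) has_sum B) UNIV"
  shows "\<bar>A - B\<bar> \<le> (\<Sum>\<^sub>\<infinity>i\<in>{1..}. \<tau> i * (p i)\<^sup>2) + 2 * c * (1 - (\<Sum>\<^sub>\<infinity>i\<in>{1..}. v i * (p i)\<^sup>2))"
proof -
  have summ_q: "q summable_on I" for I
    using has_sum_imp_summable[OF q_sum] by (rule summable_on_subset) auto
  have abs_summ: "(\<lambda>n. \<bar>q n * h n\<bar>) summable_on I" "(\<lambda>n. q n * h n) summable_on I"
      "\<bar>\<Sum>\<^sub>\<infinity>n\<in>I. q n * h n\<bar> \<le> K * (\<Sum>\<^sub>\<infinity>n\<in>I. q n)"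
    if "\<And>n. n \<in> I \<Longrightarrow> \<bar>h n\<bar> \<le> K" for h K I
  proof -
    have le: "\<bar>q n * h n\<bar> \<le> K * q n" if "n \<in> I" for n
      using mult_left_mono[OF \<open>\<And>n. n \<in> I \<Longrightarrow> \<bar>h n\<bar> \<le> K\<close>[OF that] q[of n]] q[of n] by (simp add: abs_mult ac_simps)
    have K: "(\<lambda>n. K * q n) summable_on I" by (rule summable_on_cmult_right[OF summ_q])
    from Infinite_Sum.abs_summable_on_comparison_test'[OF this, of "\<lambda>n. q n * h n"] le
    show 1: "(\<lambda>n. \<bar>q n * h n\<bar>) summable_on I" by simp
    then show "(\<lambda>n. q n * h n) summable_on I"
      using abs_summable_summable[of "\<lambda>n. q n * h n" I] by simp
    have "\<bar>\<Sum>\<^sub>\<infinity>n\<in>I. q n * h n\<bar> \<le> (\<Sum>\<^sub>\<infinity>n\<in>I. \<bar>q n * h n\<bar>)"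
      using norm_infsum_bound[of "\<lambda>n. q n * h n" I] 1 by simp
    also have "\<dots> \<le> (\<Sum>\<^sub>\<infinity>n\<in>I. K * q n)"
      by (rule infsum_mono[OF 1 K le])
    finally show "\<bar>\<Sum>\<^sub>\<infinity>n\<in>I. q n * h n\<bar> \<le> K * (\<Sum>\<^sub>\<infinity>n\<in>I. q n)"
      by (simp add: infsum_cmult_right')
  qed
  have p_eq: "(\<Sum>\<^sub>\<infinity>n\<in>{i..}. q n) = p i" for i using p by (rule infsumI)
  have p0: "0 \<le> p i" for i using p q by (rule has_sum_nonneg)
  have p1: "p i \<le> 1" for i by (rule has_sum_mono'[OF p q_sum]) (use q in auto)
  have p_lt: "(\<Sum>\<^sub>\<infinity>n\<in>{..<i}. q n) = 1 - p i" for i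
  proof -
    have "(q has_sum ((\<Sum>\<^sub>\<infinity>n\<in>{..<i}. q n) + p i)) ({..<i} \<union> {i..})"
      by (rule has_sum_Un_disjoint[OF has_sum_infsum[OF summ_q] p]) auto
    also have "{..<i} \<union> {i..} = UNIV" by auto
    finally show ?thesis using has_sum_unique[OF q_sum] by force
  qed
  \<comment> \<open>As \<open>v i * p i\<close> sums to 1, \<open>A\<close> can be distributed over
    the indices; \<open>D i\<close> is the share of index \<open>i\<close> in
    \<open>A - B\<close>.\<close>
  define D where "D i = v i * p i * A - (\<Sum>\<^sub>\<infinity>n\<in>{i..}. q n * b n i)" for i
  have "((\<lambda>i. v i * p i * A) has_sum A) {1..}"
    using has_sum_cmult_left[OF vp, of A] by simp
  from has_sum_diff[OF this has_sum_triangle_swap[OF q v summ b B]]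
  have D: "(D has_sum (A - B)) {1..}"
    by (simp add: D_def[abs_def])
  define R where "R i = \<tau> i * (p i)\<^sup>2 + 2 * c * (v i * p i - v i * (p i)\<^sup>2)" for i
  have D_le: "\<bar>D i\<bar> \<le> R i" if i: "1 \<le> i" for i
  proof -
    define E where "E = (\<Sum>\<^sub>\<infinity>n\<in>{..<i}. q n * a n)"
    define A' where "A' = (\<Sum>\<^sub>\<infinity>n\<in>{i..}. q n * a n)"
    define B' where "B' = (\<Sum>\<^sub>\<infinity>n\<in>{i..}. q n * b n i)"
    have sum_b: "(\<lambda>n. q n * b n i) summable_on {i..}"
      using b[OF i] by (intro abs_summ(2)[of _ _ "c * v i"]) auto
    have sum_a: "(\<lambda>n. q n * a n) summable_on I" for I
      using a by (intro abs_summ(2)[of _ _ c]) auto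
    have "\<bar>E\<bar> \<le> c * (1 - p i)"
      unfolding E_def p_lt[symmetric] using a by (intro abs_summ(3)) auto
    then have E: "\<bar>v i * p i * E\<bar> \<le> v i * p i * (c * (1 - p i))"
      using v[OF i] p0[of i] by (simp add: abs_mult mult_left_mono)
    have "\<bar>B'\<bar> \<le> c * v i * p i"
      unfolding B'_def p_eq[symmetric] using b[OF i] by (intro abs_summ(3)) auto
    then have B': "\<bar>(1 - p i) * B'\<bar> \<le> (1 - p i) * (c * v i * p i)"
      using p1[of i] by (simp add: abs_mult mult_left_mono)
    have "v i * A' - B' = (\<Sum>\<^sub>\<infinity>n\<in>{i..}. v i * (q n * a n) - q n * b n i)"
      unfolding A'_def B'_def
      by (intro infsumI[symmetric] has_sum_diff has_sum_cmult_right has_sum_infsum sum_a sum_b)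
    also have "\<dots> = (\<Sum>\<^sub>\<infinity>n\<in>{i..}. q n * (v i * a n - b n i))"
      by (simp add: algebra_simps)
    also have "\<bar>\<dots>\<bar> \<le> \<tau> i * p i"
      unfolding p_eq[symmetric] using ab[OF i] by (intro abs_summ(3)) auto
    finally have AB: "\<bar>p i * (v i * A' - B')\<bar> \<le> p i * (\<tau> i * p i)"
      using p0[of i] by (simp add: abs_mult mult_left_mono)
    have "((\<lambda>n. q n * a n) has_sum (E + A')) ({..<i} \<union> {i..})"
      unfolding E_def A'_def by (rule has_sum_Un_disjoint) (use sum_a in auto)
    also have "{..<i} \<union> {i..} = UNIV" by auto
    finally have "A = E + A'" using has_sum_unique[OF A] by blast
    \<comment> \<open>\<open>B'\<close> is split as \<open>p i * B' + (1 - p i) * B'\<close>. The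
      first part cancels against \<open>v i * p i * A'\<close> up to \<open>\<tau> i\<close>, with
      one factor \<open>p i\<close> in front and another from the mass of \<open>{i..}\<close>. The
      outer terms contribute \<open>c * v i * p i * (1 - p i)\<close> each, hence the constant
      \<open>2 * c\<close>.\<close>
    then have "D i = v i * p i * E + p i * (v i * A' - B') - (1 - p i) * B'"
      unfolding D_def B'_def[symmetric] by (simp add: algebra_simps)
    then have "\<bar>D i\<bar> \<le> \<bar>v i * p i * E\<bar> + \<bar>p i * (v i * A' - B')\<bar> + \<bar>(1 - p i) * B'\<bar>"
      by linarith
    also have "\<dots> \<le> v i * p i * (c * (1 - p i)) + p i * (\<tau> i * p i) + (1 - p i) * (c * v i * p i)"
      by (intro add_mono E B' AB)
    also have "\<dots> = R i"
      by (simp add: R_def algebra_simps power2_eq_square)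
    finally show ?thesis .
  qed
  have vpp: "(\<lambda>i. v i * (p i)\<^sup>2) summable_on {1..}"
  proof (rule summable_on_comparison_test[OF has_sum_imp_summable[OF vp]])
    fix i :: nat assume "i \<in> {1..}"
    then show "v i * (p i)\<^sup>2 \<le> v i * p i"
      using v[of i] p0[of i] p1[of i] by (simp add: power2_eq_square mult_left_mono mult_left_le)
  qed (use v in auto)
  have R: "(R has_sum ((\<Sum>\<^sub>\<infinity>i\<in>{1..}. \<tau> i * (p i)\<^sup>2) + 2 * c * (1 - (\<Sum>\<^sub>\<infinity>i\<in>{1..}. v i * (p i)\<^sup>2)))) {1..}"
    unfolding R_def
    by (intro has_sum_add has_sum_cmult_right has_sum_diff has_sum_infsum \<tau> vpp vp)
  have abs_D: "(\<lambda>i. \<bar>D i\<bar>) summable_on {1..}"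
    using Infinite_Sum.abs_summable_on_comparison_test'[OF has_sum_imp_summable[OF R], of D] D_le by simp
  have "\<bar>A - B\<bar> = \<bar>infsum D {1..}\<bar>" using infsumI[OF D] by simp
  also have "\<dots> \<le> (\<Sum>\<^sub>\<infinity>i\<in>{1..}. \<bar>D i\<bar>)"
    using norm_infsum_bound[of D "{1..}"] abs_D by simp
  also have "\<dots> \<le> infsum R {1..}"
    by (rule infsum_mono[OF abs_D has_sum_imp_summable[OF R]]) (use D_le in auto)
  finally show ?thesis using infsumI[OF R] by simp
qed

lemma abs_diff_le_of_DERIV:
  fixes f :: "real \<Rightarrow> real"
  assumes "\<And>x. DERIV f x :> f' x" "\<And>x. \<bar>f' x\<bar> \<le> c"
  shows "\<bar>f x - f y\<bar> \<le> c * \<bar>x - y\<bar>"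
  using field_differentiable_bound[of UNIV f f' c x y] assms by simp

text \<open>The factor 1/2 of the second-order term absorbs the bound 2; this is why the third
  absolute moment ends up with coefficient 1.\<close>

lemma taylor_remainder_le:
  fixes f :: "real \<Rightarrow> real"
  assumes f: "\<And>x. DERIV f x :> f' x" "\<And>x. DERIV f' x :> f'' x" and le: "\<And>x. \<bar>f'' x\<bar> \<le> 2"
  shows "\<bar>f (t + x) - f t - x * f' t\<bar> \<le> x\<^sup>2"
proof (cases "x = 0")
  case False
  let ?diff = "\<lambda>m::nat. if m = 0 then f else if m = 1 then f' else f''"
  have "\<exists>u. (if t + x < t then t + x < u \<and> u < t else t < u \<and> u < t + x) \<and>
    f (t + x) = (\<Sum>m<2. (?diff m t / fact m) * ((t + x) - t) ^ m) + (?diff 2 u / fact 2) * ((t + x) - t)\<^sup>2"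
    by (rule Taylor[where a="min t (t + x)" and b="max t (t + x)"])
       (use False f in \<open>auto simp: less_Suc_eq numeral_2_eq_2\<close>)
  then obtain u where "f (t + x) = (\<Sum>m<2. (?diff m t / fact m) * x ^ m) + (?diff 2 u / fact 2) * x\<^sup>2"
    by auto
  then have "f (t + x) = f t + f' t * x + f'' u / 2 * x\<^sup>2"
    by (simp add: numeral_2_eq_2)
  then have "\<bar>f (t + x) - f t - x * f' t\<bar> = \<bar>f'' u\<bar> / 2 * x\<^sup>2"
    by (simp add: abs_mult mult.commute)
  also have "\<dots> \<le> 1 * x\<^sup>2"
    using le[of u] by (intro mult_right_mono) auto
  finally show ?thesis by simp
qed simp

section \<open>Random sums\<close>

lemma abs_integral_le:
  fixes f g :: "'a \<Rightarrow> real"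
  assumes "integrable M f" "integrable M g" "\<And>x. \<bar>f x\<bar> \<le> g x"
  shows "\<bar>\<integral>x. f x \<partial>M\<bar> \<le> (\<integral>x. g x \<partial>M)"
  using assms by (intro order_trans[OF integral_abs_bound integral_mono]) auto

text \<open>Neither the Poisson law nor identical distributions enter here: the last assumption says
  that the mean of the conditional variance given \<open>N\<close> is finite. The locale is
  interpreted twice, for the summands and for the summands divided by \<sigma>.\<close>

locale random_sum = prob_space +
  fixes X :: "nat \<Rightarrow> 'a \<Rightarrow> real" and N :: "'a \<Rightarrow> nat"
  assumes indep_X: "indep_vars (\<lambda>_. borel) X {1..}"
    and X_integrable: "\<And>i. 1 \<le> i \<Longrightarrow> integrable M (X i)"
    and X_sq_integrable: "\<And>i. 1 \<le> i \<Longrightarrow> integrable M (\<lambda>\<omega>. (X i \<omega>)\<^sup>2)"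
    and X_mean: "\<And>i. 1 \<le> i \<Longrightarrow> expectation (X i) = 0"
    and measurable_N [measurable]: "N \<in> measurable M (count_space UNIV)"
    and N_indep_X: "indep_set (sets (vimage_algebra (space M) N (count_space UNIV)))
      (sets (vimage_algebra (space M) (\<lambda>\<omega>. \<lambda>i\<in>{1..}. X i \<omega>) (\<Pi>\<^sub>M i\<in>{1..}. (borel :: real measure))))"
    and summable_variance:
      "(\<lambda>n. \<P>(\<omega> in M. N \<omega> = n) * (\<Sum>i=1..n. expectation (\<lambda>\<omega>. (X i \<omega>)\<^sup>2))) summable_on UNIV"
begin

definition S :: "nat \<Rightarrow> 'a \<Rightarrow> real"
  where "S n \<omega> = (\<Sum>i=1..n. X i \<omega>)"

definition W :: "'a \<Rightarrow> real"
  where "W \<omega> = S (N \<omega>) \<omega>"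

abbreviation q :: "nat \<Rightarrow> real"
  where "q n \<equiv> \<P>(\<omega> in M. N \<omega> = n)"

abbreviation p :: "nat \<Rightarrow> real"
  where "p i \<equiv> \<P>(\<omega> in M. i \<le> N \<omega>)"

abbreviation v :: "nat \<Rightarrow> real"
  where "v i \<equiv> expectation (\<lambda>\<omega>. (X i \<omega>)\<^sup>2)"

section \<open>Independence and moments of fixed and random sums\<close>

lemma measurable_X: "1 \<le> i \<Longrightarrow> X i \<in> borel_measurable M"
  using X_integrable by blast

lemma measurable_S [measurable]: "S n \<in> borel_measurable M"
  unfolding S_def[abs_def] by (intro borel_measurable_sum measurable_X) auto

lemma measurable_W [measurable]: "W \<in> borel_measurable M"
  unfolding W_def[abs_def] by measurable

lemma q_has_sum: "(q has_sum \<P>(\<omega> in M. N \<omega> \<in> A)) A"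
proof -
  define B where "B n = {\<omega> \<in> space M. N \<omega> = n \<and> n \<in> A}" for n
  have "(\<lambda>n. measure M (B n)) sums measure M (\<Union>n. B n)"
    by (rule finite_measure_UNION) (auto simp: B_def disjoint_family_on_def)
  also have "(\<Union>n. B n) = {\<omega> \<in> space M. N \<omega> \<in> A}"
    by (auto simp: B_def)
  finally have "((\<lambda>n. measure M (B n)) has_sum \<P>(\<omega> in M. N \<omega> \<in> A)) UNIV"
    by (rule sums_nonneg_imp_has_sum) simp
  then show ?thesis
    by (rule has_sum_cong_neutral[THEN iffD1, rotated -1]) (auto simp: B_def)
qed

lemma q_has_sum_1: "(q has_sum 1) UNIV"
  using q_has_sum[of UNIV] by (simp add: prob_space)

lemma q_has_sum_p: "(q has_sum p i) {i..}"
  using q_has_sum[of "{i..}"] by simp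

text \<open>Both variables generate sub-\<sigma>-algebras of the two independent ones.
  \<open>N\<close> is cast to the reals because \<open>indep_var\<close> relates variables with a
  common value type.\<close>

lemma indep_N_S: "indep_var borel (\<lambda>\<omega>. real (N \<omega>)) borel (S n)"
proof -
  let ?X = "\<lambda>\<omega>. \<lambda>i\<in>{1..}. X i \<omega>" and ?P = "\<Pi>\<^sub>M i\<in>{1..}. (borel :: real measure)"
  let ?VN = "vimage_algebra (space M) N (count_space UNIV)" and ?VX = "vimage_algebra (space M) ?X ?P"
  have "sigma_sets (space ?VN) {(\<lambda>\<omega>. real (N \<omega>)) -` A \<inter> space M | A. A \<in> sets borel} \<subseteq> sets ?VN"
  proof (rule sets.sigma_sets_subset, safe)
    fix A :: "real set"
    have "N -` (real -` A) \<inter> space M \<in> sets ?VN" by (rule in_vimage_algebra) simp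
    then show "(\<lambda>\<omega>. real (N \<omega>)) -` A \<inter> space M \<in> sets ?VN" by (simp add: vimage_def)
  qed
  moreover have "sigma_sets (space ?VX) {S n -` A \<inter> space M | A. A \<in> sets borel} \<subseteq> sets ?VX"
  proof (rule sets.sigma_sets_subset, safe)
    fix A :: "real set" assume A: "A \<in> sets borel"
    let ?h = "\<lambda>x. \<Sum>i=1..n. x i"
    have "?h \<in> borel_measurable ?P"
      by (intro borel_measurable_sum measurable_component_singleton) auto
    from in_vimage_algebra[OF measurable_sets[OF this A]]
    have "?X -` (?h -` A \<inter> space ?P) \<inter> space M \<in> sets ?VX" .
    also have "?X -` (?h -` A \<inter> space ?P) \<inter> space M = S n -` A \<inter> space M"
    proof -
      have "?h (?X \<omega>) = S n \<omega>" for \<omega>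
        unfolding S_def by (rule sum.cong) auto
      then show ?thesis by (auto simp: space_PiM)
    qed
    finally show "S n -` A \<inter> space M \<in> sets ?VX" .
  qed
  ultimately have "indep_set
      (sigma_sets (space M) {(\<lambda>\<omega>. real (N \<omega>)) -` A \<inter> space M | A. A \<in> sets borel})
      (sigma_sets (space M) {S n -` A \<inter> space M | A. A \<in> sets borel})"
    using N_indep_X unfolding indep_sets2_eq space_vimage_algebra by (meson subset_iff order_trans)
  then show ?thesis
    unfolding indep_var_eq by (intro conjI) measurable
qed

lemma indep_X_rest:
  assumes "i \<in> {1..n}"
  shows "indep_var borel (X i) borel (\<lambda>\<omega>. \<Sum>j\<in>{1..n} - {i}. X j \<omega>)"
  using assms by (intro indep_vars_sum indep_vars_subset[OF indep_X]) auto

text \<open>Independence and zero means remove the cross terms. Arbitrary finite index sets are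
  allowed because the leave-one-out sum runs over \<open>{1..n} - {i}\<close>.\<close>

lemma sum_square_integral:
  assumes "finite I" "I \<subseteq> {1..}"
  shows "integrable M (\<lambda>\<omega>. \<Sum>i\<in>I. X i \<omega>) \<and> integrable M (\<lambda>\<omega>. (\<Sum>i\<in>I. X i \<omega>)\<^sup>2)
    \<and> expectation (\<lambda>\<omega>. \<Sum>i\<in>I. X i \<omega>) = 0 \<and> expectation (\<lambda>\<omega>. (\<Sum>i\<in>I. X i \<omega>)\<^sup>2) = (\<Sum>i\<in>I. v i)"
  using assms
proof (induction rule: finite_induct)
  case (insert i I)
  let ?T = "\<lambda>\<omega>. \<Sum>i\<in>I. X i \<omega>"
  have i: "1 \<le> i" using insert.prems by auto
  have T: "integrable M ?T" "integrable M (\<lambda>\<omega>. (?T \<omega>)\<^sup>2)" "expectation ?T = 0"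
      "expectation (\<lambda>\<omega>. (?T \<omega>)\<^sup>2) = (\<Sum>i\<in>I. v i)"
    using insert by auto
  have ind: "indep_var borel (X i) borel ?T"
    using insert by (intro indep_vars_sum indep_vars_subset[OF indep_X]) auto
  have prod: "integrable M (\<lambda>\<omega>. X i \<omega> * ?T \<omega>)" "expectation (\<lambda>\<omega>. X i \<omega> * ?T \<omega>) = 0"
    using indep_var_integrable[OF ind X_integrable[OF i] T(1)]
      indep_var_lebesgue_integral[OF ind X_integrable[OF i] T(1)] X_mean[OF i] by auto
  have sq: "(X i \<omega> + ?T \<omega>)\<^sup>2 = (X i \<omega>)\<^sup>2 + 2 * (X i \<omega> * ?T \<omega>) + (?T \<omega>)\<^sup>2" for \<omega>
    by (simp add: power2_sum)
  show ?case
    using insert.hyps T prod X_integrable[OF i] X_sq_integrable[OF i] X_mean[OF i]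
    by (simp add: sq)
qed auto

lemma
  shows S_sq_integrable: "integrable M (\<lambda>\<omega>. (S n \<omega>)\<^sup>2)"
    and S_mean: "expectation (S n) = 0"
    and S_sq_mean: "expectation (\<lambda>\<omega>. (S n \<omega>)\<^sup>2) = (\<Sum>i=1..n. v i)"
  using sum_square_integral[of "{1..n}"] by (auto simp: S_def[abs_def])

lemma integrable_quadratic_bound:
  fixes g :: "'a \<Rightarrow> real"
  assumes [measurable]: "g \<in> borel_measurable M" and "integrable M (\<lambda>\<omega>. (T \<omega>)\<^sup>2)"
    and le: "\<And>\<omega>. \<bar>g \<omega>\<bar> \<le> K * (1 + (T \<omega>)\<^sup>2)"
  shows "integrable M g"
proof (rule Bochner_Integration.integrable_bound)
  show "integrable M (\<lambda>\<omega>. K * (1 + (T \<omega>)\<^sup>2))" using assms by simp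
  show "AE \<omega> in M. norm (g \<omega>) \<le> norm (K * (1 + (T \<omega>)\<^sup>2))"
    using le by (auto intro: order_trans[OF _ abs_ge_self])
qed simp

text \<open>Expand \<open>g(W)\<close> over the events \<open>N = n\<close>; on each,
  \<open>N\<close> is independent of \<open>S n\<close>. Quadratic growth of \<open>g\<close> and
  \<open>summable_variance\<close> make the series of absolute means converge, so sum and
  expectation may be exchanged.\<close>

lemma expectation_W:
  fixes g :: "real \<Rightarrow> real"
  assumes [measurable]: "g \<in> borel_measurable borel" and le: "\<And>x. \<bar>g x\<bar> \<le> K * (1 + x\<^sup>2)"
  shows "integrable M (\<lambda>\<omega>. g (W \<omega>))"
    and "((\<lambda>n. q n * expectation (\<lambda>\<omega>. g (S n \<omega>))) has_sum expectation (\<lambda>\<omega>. g (W \<omega>))) UNIV"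
proof -
  define h where "h n \<omega> = indicator {n} (N \<omega>) * g (S n \<omega>)" for n \<omega>
  have [measurable]: "indicator {n} \<in> borel_measurable (count_space UNIV :: nat measure)" for n
    by simp
  have q: "expectation (\<lambda>\<omega>. indicator {n} (N \<omega>) :: real) = q n" for n
  proof -
    have "expectation (\<lambda>\<omega>. indicator {n} (N \<omega>) :: real) = expectation (indicator {\<omega>\<in>space M. N \<omega> = n})"
      by (intro Bochner_Integration.integral_cong) (auto split: split_indicator)
    then show ?thesis by simp
  qed
  have int_ind: "integrable M (\<lambda>\<omega>. indicator {n} (N \<omega>) :: real)" for n
    by (intro integrable_const_bound[where B=1]) auto
  have int_g: "integrable M (\<lambda>\<omega>. g (S n \<omega>))" for n
    by (rule integrable_quadratic_bound[OF _ S_sq_integrable le]) simp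
  have indep: "indep_var borel (\<lambda>\<omega>. indicator {n} (N \<omega>) :: real) borel (\<lambda>\<omega>. f (S n \<omega>))"
    if "f \<in> borel_measurable borel" for n and f :: "real \<Rightarrow> real"
    using indep_var_compose[OF indep_N_S, of "indicator {real n}" borel f borel n] that
    by (simp add: comp_def indicator_def)
  have int_h: "integrable M (h n)" for n
    unfolding h_def using indep_var_integrable[OF indep int_ind int_g] by simp
  have E_h: "expectation (h n) = q n * expectation (\<lambda>\<omega>. g (S n \<omega>))" for n
    unfolding h_def using indep_var_lebesgue_integral[OF indep int_ind int_g] by (simp add: q)
  have E_abs_h: "expectation (\<lambda>\<omega>. norm (h n \<omega>)) = q n * expectation (\<lambda>\<omega>. \<bar>g (S n \<omega>)\<bar>)" for n
    using indep_var_lebesgue_integral[OF indep[of "\<lambda>x. \<bar>g x\<bar>"] int_ind, of n] int_g[of n]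
    by (simp add: h_def[abs_def] q abs_mult)
  have "summable (\<lambda>n. q n * (K * (1 + (\<Sum>i=1..n. v i))))"
  proof -
    have "(\<lambda>n. K * (q n + q n * (\<Sum>i=1..n. v i))) summable_on UNIV"
      by (intro summable_on_cmult_right summable_on_add has_sum_imp_summable[OF q_has_sum_1] summable_variance)
    then show ?thesis
      by (intro summable_on_imp_summable) (simp add: algebra_simps)
  qed
  then have summ: "summable (\<lambda>n. expectation (\<lambda>\<omega>. norm (h n \<omega>)))"
  proof (rule summable_comparison_test'[of _ 0])
    fix n
    have "expectation (\<lambda>\<omega>. \<bar>g (S n \<omega>)\<bar>) \<le> expectation (\<lambda>\<omega>. K * (1 + (S n \<omega>)\<^sup>2))"
      using int_g le by (intro integral_mono) (auto simp: S_sq_integrable)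
    also have "\<dots> = K * (1 + (\<Sum>i=1..n. v i))"
      by (simp add: S_sq_integrable S_sq_mean prob_space)
    finally show "norm (expectation (\<lambda>\<omega>. norm (h n \<omega>))) \<le> q n * (K * (1 + (\<Sum>i=1..n. v i)))"
      by (simp add: E_abs_h[unfolded real_norm_def] abs_mult mult_left_mono)
  qed
  have fin: "h n \<omega> = 0" if "n \<notin> {N \<omega>}" for n \<omega>
    using that by (simp add: h_def)
  have AE: "AE \<omega> in M. summable (\<lambda>n. norm (h n \<omega>))"
  proof (rule AE_I2)
    show "summable (\<lambda>n. norm (h n \<omega>))" for \<omega>
      by (rule summable_finite[of "{N \<omega>}"]) (auto simp: fin)
  qed
  have suminf: "(\<Sum>n. h n \<omega>) = g (W \<omega>)" for \<omega>
    using suminf_finite[of "{N \<omega>}" "\<lambda>n. h n \<omega>"] fin by (simp add: h_def W_def)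
  show "integrable M (\<lambda>\<omega>. g (W \<omega>))"
    using integrable_suminf[OF int_h AE summ] by (simp add: suminf)
  have "(\<lambda>n. expectation (h n)) sums expectation (\<lambda>\<omega>. g (W \<omega>))"
    using sums_integral[OF int_h AE summ] by (simp add: suminf)
  moreover have "summable (\<lambda>n. norm (expectation (h n)))"
    by (rule summable_comparison_test'[OF summ, of 0]) (simp add: integral_norm_bound)
  ultimately show "((\<lambda>n. q n * expectation (\<lambda>\<omega>. g (S n \<omega>))) has_sum expectation (\<lambda>\<omega>. g (W \<omega>))) UNIV"
    unfolding E_h[symmetric] by (intro norm_summable_imp_has_sum)
qed

lemma abs_le_quadratic: "\<bar>x::real\<bar> \<le> 1 * (1 + x\<^sup>2)"
proof -
  have "0 \<le> (\<bar>x\<bar> - 1)\<^sup>2" by simp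
  then have "2 * \<bar>x\<bar> \<le> 1 + x\<^sup>2" by (simp add: power2_diff)
  then show ?thesis by simp
qed

lemma W_integrable: "integrable M W"
  using expectation_W(1)[of "\<lambda>x. x" 1] abs_le_quadratic by simp

lemma W_mean: "expectation W = 0"
  using expectation_W(2)[of "\<lambda>x. x" 1] abs_le_quadratic
  by (simp add: S_mean) (metis has_sum_0 has_sum_unique)

text \<open>Given \<open>N = n\<close> the variance is the sum of the first \<open>n\<close> terms
  \<open>v i\<close>. Exchanging the summations collects the weights with \<open>n \<ge> i\<close>
  into \<open>p i\<close>.\<close>

lemma W_variance: "((\<lambda>i. v i * p i) has_sum variance W) {1..}"
proof -
  have "((\<lambda>n. q n * (\<Sum>i=1..n. v i)) has_sum variance W) UNIV"
    using expectation_W(2)[of "\<lambda>x. x\<^sup>2" 1] by (simp add: S_sq_mean W_mean)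
  from has_sum_triangle_swap[where C=1, OF _ _ summable_variance _ this]
  have "((\<lambda>i. \<Sum>\<^sub>\<infinity>n\<in>{i..}. q n * v i) has_sum variance W) {1..}"
    by simp
  moreover have "(\<Sum>\<^sub>\<infinity>n\<in>{i..}. q n * v i) = v i * p i" for i
    using infsumI[OF q_has_sum_p[of i]] by (subst infsum_cmult_left') (simp only: mult.commute)
  ultimately show ?thesis by simp
qed

text \<open>Real-valued counterpart of \<open>third_moment_term\<close>; the two are identified only
  when the third absolute moment is finite.\<close>

definition third_moment :: "nat \<Rightarrow> real"
  where "third_moment i = expectation (\<lambda>\<omega>. \<bar>X i \<omega>\<bar> ^ 3) + 2 * v i * expectation (\<lambda>\<omega>. \<bar>X i \<omega>\<bar>)"

text \<open>
  Leave-one-out: \<open>X i\<close> is independent of \<open>T = S n - X i\<close>, so \<open>E (X i f (S n)) = E (X i (f (S n) - f T))\<close>,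
  and the increment of \<open>f\<close> is \<open>X i f' T\<close> up to second order.
\<close>

lemma
  assumes f: "\<And>x. DERIV f x :> f' x" "\<And>x. DERIV f' x :> f'' x"
    and f'_le: "\<And>x. \<bar>f' x\<bar> \<le> c" and f''_le: "\<And>x. \<bar>f'' x\<bar> \<le> 2"
    and i: "1 \<le> i" "i \<le> n"
  shows integrable_leave_one_out: "integrable M (\<lambda>\<omega>. X i \<omega> * f (S n \<omega>))"
    and leave_one_out_bound: "\<bar>expectation (\<lambda>\<omega>. X i \<omega> * f (S n \<omega>))\<bar> \<le> c * v i"
    and leave_one_out_approx: "integrable M (\<lambda>\<omega>. \<bar>X i \<omega>\<bar> ^ 3) \<Longrightarrow>
      \<bar>v i * expectation (\<lambda>\<omega>. f' (S n \<omega>)) - expectation (\<lambda>\<omega>. X i \<omega> * f (S n \<omega>))\<bar> \<le> third_moment i"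
proof -
  define T where "T \<omega> = (\<Sum>j\<in>{1..n} - {i}. X j \<omega>)" for \<omega>
  have S: "S n \<omega> = T \<omega> + X i \<omega>" for \<omega>
    unfolding S_def T_def using i by (subst sum.remove[of _ i]) auto
  note [measurable] = measurable_X[OF i(1)]
  have [measurable]: "f \<in> borel_measurable borel" "f' \<in> borel_measurable borel"
    using DERIV_isCont[OF f(1)] DERIV_isCont[OF f(2)]
    by (auto intro!: borel_measurable_continuous_onI continuous_at_imp_continuous_on)
  have T: "integrable M T"
    unfolding T_def[abs_def] by (rule sum_square_integral[THEN conjunct1]) auto
  then have [measurable]: "T \<in> borel_measurable M" by simp
  have ind: "indep_var borel (X i) borel T"
    using indep_X_rest[of i n] i by (simp add: T_def[abs_def])
  have lip: "\<bar>f x - f y\<bar> \<le> c * \<bar>x - y\<bar>" for x y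
    by (rule abs_diff_le_of_DERIV[OF f(1) f'_le])
  have lip': "\<bar>f' x - f' y\<bar> \<le> 2 * \<bar>x - y\<bar>" for x y
    by (rule abs_diff_le_of_DERIV[OF f(2) f''_le])
  note X = X_integrable[OF i(1)] and X2 = X_sq_integrable[OF i(1)]
  have int_fT: "integrable M (\<lambda>\<omega>. f (T \<omega>))"
  proof (rule Bochner_Integration.integrable_bound)
    show "integrable M (\<lambda>\<omega>. \<bar>f 0\<bar> + c * \<bar>T \<omega>\<bar>)" using T by simp
    have "\<bar>f x\<bar> \<le> \<bar>f 0\<bar> + c * \<bar>x\<bar>" for x
      using lip[of x 0] by simp
    then show "AE \<omega> in M. norm (f (T \<omega>)) \<le> norm (\<bar>f 0\<bar> + c * \<bar>T \<omega>\<bar>)"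
      by (auto intro: order_trans[OF _ abs_ge_self])
  qed simp
  have ind_f: "indep_var borel (X i) borel (\<lambda>\<omega>. f (T \<omega>))"
    using indep_var_compose[OF ind, of id borel f borel] by (simp add: comp_def)
  have int_XfT: "integrable M (\<lambda>\<omega>. X i \<omega> * f (T \<omega>))"
    and E_XfT: "expectation (\<lambda>\<omega>. X i \<omega> * f (T \<omega>)) = 0"
    using indep_var_integrable[OF ind_f X int_fT] indep_var_lebesgue_integral[OF ind_f X int_fT] X_mean[OF i(1)]
    by auto
  \<comment> \<open>The Lipschitz bound on \<open>f\<close> controls \<open>D\<close> by
    \<open>c\<close> times the square of \<open>X i\<close>, so the crude estimate holds with second
    moments alone.\<close>
  define D where "D \<omega> = X i \<omega> * (f (S n \<omega>) - f (T \<omega>))" for \<omega>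
  have D_le: "\<bar>D \<omega>\<bar> \<le> c * (X i \<omega>)\<^sup>2" for \<omega>
  proof -
    have "\<bar>D \<omega>\<bar> \<le> \<bar>X i \<omega>\<bar> * (c * \<bar>X i \<omega>\<bar>)"
      unfolding D_def abs_mult using lip[of "S n \<omega>" "T \<omega>"] by (intro mult_left_mono) (auto simp: S)
    also have "\<dots> = c * \<bar>X i \<omega>\<bar>\<^sup>2" by (simp only: power2_eq_square ac_simps)
    finally show ?thesis by simp
  qed
  have int_D: "integrable M D"
  proof (rule Bochner_Integration.integrable_bound)
    show "integrable M (\<lambda>\<omega>. c * (X i \<omega>)\<^sup>2)" using X2 by simp
    show "AE \<omega> in M. norm (D \<omega>) \<le> norm (c * (X i \<omega>)\<^sup>2)"
      using D_le by (auto intro: order_trans[OF _ abs_ge_self])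
  qed (simp add: D_def[abs_def])
  have XfS: "X i \<omega> * f (S n \<omega>) = D \<omega> + X i \<omega> * f (T \<omega>)" for \<omega>
    by (simp add: D_def algebra_simps)
  show "integrable M (\<lambda>\<omega>. X i \<omega> * f (S n \<omega>))"
    unfolding XfS using int_D int_XfT by simp
  have E_XfS: "expectation (\<lambda>\<omega>. X i \<omega> * f (S n \<omega>)) = expectation D"
    unfolding XfS using int_D int_XfT E_XfT by simp
  have "\<bar>expectation D\<bar> \<le> expectation (\<lambda>\<omega>. c * (X i \<omega>)\<^sup>2)"
    using int_D X2 D_le by (intro abs_integral_le) auto
  then show "\<bar>expectation (\<lambda>\<omega>. X i \<omega> * f (S n \<omega>))\<bar> \<le> c * v i"
    by (simp add: E_XfS)
  assume X3: "integrable M (\<lambda>\<omega>. \<bar>X i \<omega>\<bar> ^ 3)"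
  have int_f'T: "integrable M (\<lambda>\<omega>. f' (T \<omega>))" and int_f'S: "integrable M (\<lambda>\<omega>. f' (S n \<omega>))"
    using f'_le by (auto intro!: integrable_const_bound[where B=c])
  have ind_f': "indep_var borel (\<lambda>\<omega>. (X i \<omega>)\<^sup>2) borel (\<lambda>\<omega>. f' (T \<omega>))"
    using indep_var_compose[OF ind, of "\<lambda>x. x\<^sup>2" borel f' borel] by (simp add: comp_def)
  have int_X2f': "integrable M (\<lambda>\<omega>. (X i \<omega>)\<^sup>2 * f' (T \<omega>))"
    and E_X2f': "expectation (\<lambda>\<omega>. (X i \<omega>)\<^sup>2 * f' (T \<omega>)) = v i * expectation (\<lambda>\<omega>. f' (T \<omega>))"
    using indep_var_integrable[OF ind_f' X2 int_f'T] indep_var_lebesgue_integral[OF ind_f' X2 int_f'T] by auto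
  \<comment> \<open>The integrand is \<open>X i\<close> times a Taylor remainder of \<open>f\<close>
    at \<open>T\<close>, and \<open>f' T\<close> is independent of \<open>X i\<close>.\<close>
  have "\<bar>expectation (\<lambda>\<omega>. D \<omega> - (X i \<omega>)\<^sup>2 * f' (T \<omega>))\<bar> \<le> expectation (\<lambda>\<omega>. \<bar>X i \<omega>\<bar> ^ 3)"
  proof (rule abs_integral_le)
    fix \<omega>
    have "D \<omega> - (X i \<omega>)\<^sup>2 * f' (T \<omega>) = X i \<omega> * (f (T \<omega> + X i \<omega>) - f (T \<omega>) - X i \<omega> * f' (T \<omega>))"
      by (simp add: D_def S algebra_simps power2_eq_square)
    also have "\<bar>\<dots>\<bar> \<le> \<bar>X i \<omega>\<bar> * (X i \<omega>)\<^sup>2"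
      unfolding abs_mult by (intro mult_left_mono taylor_remainder_le[OF f f''_le]) auto
    also have "\<dots> = \<bar>X i \<omega>\<bar> ^ 3"
      by (simp add: power3_eq_cube power2_eq_square abs_mult[symmetric])
    finally show "\<bar>D \<omega> - (X i \<omega>)\<^sup>2 * f' (T \<omega>)\<bar> \<le> \<bar>X i \<omega>\<bar> ^ 3" .
  qed (use int_D int_X2f' X3 in auto)
  then have 1: "\<bar>expectation D - v i * expectation (\<lambda>\<omega>. f' (T \<omega>))\<bar> \<le> expectation (\<lambda>\<omega>. \<bar>X i \<omega>\<bar> ^ 3)"
    using int_D int_X2f' by (simp add: E_X2f')
  \<comment> \<open>Returning from \<open>T\<close> to \<open>S n\<close>, a quantity not depending
    on \<open>i\<close>, costs the second summand of \<open>third_moment\<close>.\<close>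
  have "\<bar>expectation (\<lambda>\<omega>. f' (S n \<omega>) - f' (T \<omega>))\<bar> \<le> expectation (\<lambda>\<omega>. 2 * \<bar>X i \<omega>\<bar>)"
  proof (rule abs_integral_le)
    show "\<bar>f' (S n \<omega>) - f' (T \<omega>)\<bar> \<le> 2 * \<bar>X i \<omega>\<bar>" for \<omega>
      using lip'[of "S n \<omega>" "T \<omega>"] by (simp add: S)
  qed (use int_f'S int_f'T X in auto)
  then have 2: "\<bar>expectation (\<lambda>\<omega>. f' (S n \<omega>)) - expectation (\<lambda>\<omega>. f' (T \<omega>))\<bar> \<le> 2 * expectation (\<lambda>\<omega>. \<bar>X i \<omega>\<bar>)"
    using int_f'S int_f'T by simp
  have "0 \<le> v i" by simp
  from mult_left_mono[OF 2 this]
  have "\<bar>v i * expectation (\<lambda>\<omega>. f' (S n \<omega>)) - v i * expectation (\<lambda>\<omega>. f' (T \<omega>))\<bar> \<le> 2 * v i * expectation (\<lambda>\<omega>. \<bar>X i \<omega>\<bar>)"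
    using \<open>0 \<le> v i\<close> by (simp add: abs_mult right_diff_distrib[symmetric] del: Bochner_Integration.integral_nonneg)
  with 1 show "\<bar>v i * expectation (\<lambda>\<omega>. f' (S n \<omega>)) - expectation (\<lambda>\<omega>. X i \<omega> * f (S n \<omega>))\<bar> \<le> third_moment i"
    unfolding E_XfS third_moment_def by linarith
qed

text \<open>An instance of \<open>random_index_bound\<close> with \<open>a n = E f'(S n)\<close> and
  \<open>b n i = E (X i f(S n))\<close>. Linear growth of \<open>f\<close> makes
  \<open>x * f x\<close> quadratic, so that \<open>expectation_W\<close> identifies both
  totals.\<close>

lemma stein_W:
  assumes var: "variance W = 1"
    and X3: "\<And>i. 1 \<le> i \<Longrightarrow> integrable M (\<lambda>\<omega>. \<bar>X i \<omega>\<bar> ^ 3)"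
    and summ: "(\<lambda>i. third_moment i * (p i)\<^sup>2) summable_on {1..}"
    and f: "\<And>x. DERIV f x :> f' x" "\<And>x. DERIV f' x :> f'' x"
    and f'_le: "\<And>x. \<bar>f' x\<bar> \<le> c" and f''_le: "\<And>x. \<bar>f'' x\<bar> \<le> 2"
  shows "expectation (\<lambda>\<omega>. f' (W \<omega>) - W \<omega> * f (W \<omega>))
    \<le> (\<Sum>\<^sub>\<infinity>i\<in>{1..}. third_moment i * (p i)\<^sup>2) + 2 * c * (1 - (\<Sum>\<^sub>\<infinity>i\<in>{1..}. v i * (p i)\<^sup>2))"
proof -
  have [measurable]: "f \<in> borel_measurable borel" "f' \<in> borel_measurable borel"
    using DERIV_isCont[OF f(1)] DERIV_isCont[OF f(2)]
    by (auto intro!: borel_measurable_continuous_onI continuous_at_imp_continuous_on)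
  have c: "0 \<le> c" using f'_le[of 0] by linarith
  have le1: "\<bar>f' x\<bar> \<le> c * (1 + x\<^sup>2)" for x
    using f'_le[of x] mult_left_mono[OF _ c, of 1 "1 + x\<^sup>2"] by simp
  have le2: "\<bar>x * f x\<bar> \<le> (\<bar>f 0\<bar> + c) * (1 + x\<^sup>2)" for x
  proof -
    have "\<bar>f x\<bar> \<le> \<bar>f 0\<bar> + c * \<bar>x\<bar>"
      using abs_diff_le_of_DERIV[OF f(1) f'_le, of x 0] by simp
    then have "\<bar>x * f x\<bar> \<le> \<bar>x\<bar> * (\<bar>f 0\<bar> + c * \<bar>x\<bar>)"
      unfolding abs_mult by (intro mult_left_mono) auto
    also have "\<dots> = \<bar>f 0\<bar> * \<bar>x\<bar> + c * \<bar>x\<bar>\<^sup>2"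
      by (simp only: power2_eq_square algebra_simps)
    also have "\<dots> \<le> \<bar>f 0\<bar> * (1 + x\<^sup>2) + c * (1 + x\<^sup>2)"
      using abs_le_quadratic[of x] c by (intro add_mono mult_left_mono) auto
    finally show ?thesis by (simp add: algebra_simps)
  qed
  note W1 = expectation_W[of f' c, OF _ le1] and W2 = expectation_W[of "\<lambda>x. x * f x", OF _ le2]
  note loo = f f'_le f''_le
  have "expectation (\<lambda>\<omega>. S n \<omega> * f (S n \<omega>)) = (\<Sum>i=1..n. expectation (\<lambda>\<omega>. X i \<omega> * f (S n \<omega>)))" for n
    using integrable_leave_one_out[OF loo]
    by (subst S_def) (simp add: sum_distrib_right)
  then have W2': "((\<lambda>n. q n * (\<Sum>i=1..n. expectation (\<lambda>\<omega>. X i \<omega> * f (S n \<omega>))))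
      has_sum expectation (\<lambda>\<omega>. W \<omega> * f (W \<omega>))) UNIV"
    using W2(2) by simp
  have "\<bar>expectation (\<lambda>\<omega>. f' (W \<omega>)) - expectation (\<lambda>\<omega>. W \<omega> * f (W \<omega>))\<bar>
    \<le> (\<Sum>\<^sub>\<infinity>i\<in>{1..}. third_moment i * (p i)\<^sup>2) + 2 * c * (1 - (\<Sum>\<^sub>\<infinity>i\<in>{1..}. v i * (p i)\<^sup>2))"
  proof (rule random_index_bound[OF _ q_has_sum_1 q_has_sum_p _ _ summable_variance _ _ _ summ _ W2'])
    show "((\<lambda>i. v i * p i) has_sum 1) {1..}" using W_variance by (simp add: var)
    show "\<bar>expectation (\<lambda>\<omega>. f' (S n \<omega>))\<bar> \<le> c" for n
    proof -
      have "\<bar>expectation (\<lambda>\<omega>. f' (S n \<omega>))\<bar> \<le> expectation (\<lambda>_. c)"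
      proof (rule abs_integral_le)
        show "integrable M (\<lambda>\<omega>. f' (S n \<omega>))"
          using f'_le by (intro integrable_const_bound[where B=c]) auto
      qed (use f'_le in auto)
      then show ?thesis by (simp add: prob_space)
    qed
  qed (use leave_one_out_bound[OF loo] leave_one_out_approx[OF loo] X3 W1 in auto)
  then show ?thesis
    using W1(1) W2(1) by simp
qed

theorem wasserstein_dist_W_le:
  assumes "variance W = 1"
    and "\<And>i. 1 \<le> i \<Longrightarrow> integrable M (\<lambda>\<omega>. \<bar>X i \<omega>\<bar> ^ 3)"
    and "(\<lambda>i. third_moment i * (p i)\<^sup>2) summable_on {1..}"
  shows "wasserstein_dist (distr M borel W) std_normal_distribution
    \<le> ennreal ((\<Sum>\<^sub>\<infinity>i\<in>{1..}. third_moment i * (p i)\<^sup>2)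
        + 4 / sqrt (2 * pi) * (1 - (\<Sum>\<^sub>\<infinity>i\<in>{1..}. v i * (p i)\<^sup>2)))"
proof -
  interpret P: real_distribution "distr M borel W" by (rule real_distribution_distr) simp
  show ?thesis
  proof (rule P.wasserstein_dist_std_normal_le)
    show "integrable (distr M borel W) (\<lambda>x. x)"
      using W_integrable by (subst integrable_distr_eq) auto
    fix f f' f'' :: "real \<Rightarrow> real"
    assume f: "\<And>w. DERIV f w :> f' w" "\<And>w. DERIV f' w :> f'' w"
      "\<And>w. \<bar>f' w\<bar> \<le> 2 / sqrt (2 * pi)" "\<And>w. \<bar>f'' w\<bar> \<le> 2"
    have [measurable]: "f \<in> borel_measurable borel" "f' \<in> borel_measurable borel"
      using DERIV_isCont[OF f(1)] DERIV_isCont[OF f(2)]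
      by (auto intro!: borel_measurable_continuous_onI continuous_at_imp_continuous_on)
    have "(\<integral>x. f' x - x * f x \<partial>distr M borel W) = expectation (\<lambda>\<omega>. f' (W \<omega>) - W \<omega> * f (W \<omega>))"
      by (subst integral_distr) auto
    also have "\<dots> \<le> (\<Sum>\<^sub>\<infinity>i\<in>{1..}. third_moment i * (p i)\<^sup>2)
        + 2 * (2 / sqrt (2 * pi)) * (1 - (\<Sum>\<^sub>\<infinity>i\<in>{1..}. v i * (p i)\<^sup>2))"
      by (rule stein_W[OF assms f])
    finally show "(\<integral>x. f' x - x * f x \<partial>distr M borel W) \<le> (\<Sum>\<^sub>\<infinity>i\<in>{1..}. third_moment i * (p i)\<^sup>2)
        + 4 / sqrt (2 * pi) * (1 - (\<Sum>\<^sub>\<infinity>i\<in>{1..}. v i * (p i)\<^sup>2))" by simp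
  qed
qed

end

section \<open>Poisson sums of four groups\<close>

lemma infsum_ennreal_eq:
  fixes f :: "'b \<Rightarrow> real"
  assumes "f summable_on A" "\<And>x. x \<in> A \<Longrightarrow> 0 \<le> f x"
  shows "(\<Sum>\<^sub>\<infinity>x\<in>A. ennreal (f x)) = ennreal (infsum f A)"
proof -
  have "(\<Sum>\<^sub>\<infinity>x\<in>A. ennreal (f x)) = (SUP F\<in>{F. finite F \<and> F \<subseteq> A}. \<Sum>x\<in>F. ennreal (f x))"
    by (rule nonneg_infsum_complete) simp
  also have "\<dots> = (SUP F\<in>{F. finite F \<and> F \<subseteq> A}. ennreal (sum f F))"
    by (intro SUP_cong refl sum_ennreal) (use assms in auto)
  also have "\<dots> = ennreal (infsum f A)"
    by (rule infsum_nonneg_is_SUPREMUM_ennreal[OF assms, symmetric])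
  finally show ?thesis .
qed

lemma ennreal_le_infsum:
  fixes f :: "'b \<Rightarrow> ennreal"
  assumes "x \<in> A"
  shows "f x \<le> infsum f A"
  using infsum_mono_neutral[of f "{x}" f A] assms by (simp add: nonneg_summable_on_complete)

text \<open>For negative \<open>b\<close> the right side drops the second summand, as
  \<open>ennreal b\<close> is 0. Thus the sign of the last bracket of the final bound never has to
  be determined.\<close>

lemma ennreal_add_le: "0 \<le> a \<Longrightarrow> ennreal (a + b) \<le> ennreal a + ennreal b"
  by (cases "0 \<le> b") (auto simp: ennreal_neg intro!: ennreal_leI)

text \<open>General in the value type because the groups are separated both in real sums and in sums
  of type \<open>ennreal\<close>.\<close>

lemma infsum_split_four:
  fixes f :: "nat \<Rightarrow> 'b :: {topological_comm_monoid_add, t2_space}"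
  assumes "n1 \<le> n2" "n2 \<le> n3" "f summable_on {n3+1..}"
  shows "infsum f {1..} = sum f {1..n1} + sum f {n1+1..n2} + sum f {n2+1..n3} + infsum f {n3+1..}"
proof -
  have "{1..} = {1..n1} \<union> {n1+1..n2} \<union> {n2+1..n3} \<union> {n3+1..}"
    using assms by auto
  moreover have "infsum f \<dots> = infsum f ({1..n1} \<union> {n1+1..n2} \<union> {n2+1..n3}) + infsum f {n3+1..}"
    using assms by (intro infsum_Un_disjoint) auto
  moreover have "sum f ({1..n1} \<union> {n1+1..n2} \<union> {n2+1..n3}) = sum f {1..n1} + sum f {n1+1..n2} + sum f {n2+1..n3}"
    using assms by (subst sum.union_disjoint; auto)+
  ultimately show ?thesis by simp
qed

lemma summable_poisson_mean: "summable (\<lambda>n. lam ^ n / fact n * exp (- lam) * real n)"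
proof -
  have "summable (\<lambda>n. lam * exp (- lam) * (inverse (fact n) * lam ^ n))"
    by (intro summable_mult summable_exp)
  \<comment> \<open>Cancelling \<open>Suc n\<close> in the factorial turns the shifted series into
    the exponential one.\<close>
  also have "(\<lambda>n. lam * exp (- lam) * (inverse (fact n) * lam ^ n))
      = (\<lambda>n. lam ^ Suc n / fact (Suc n) * exp (- lam) * real (Suc n))"
    by (auto simp: fun_eq_iff field_simps simp del: of_nat_Suc)
  finally show ?thesis by (subst (asm) summable_Suc_iff)
qed

theorem corollary3p4:
  fixes M :: "'a measure" and X :: "nat \<Rightarrow> 'a \<Rightarrow> real" and N :: "'a \<Rightarrow> nat"
    and n1 n2 n3 :: nat and lam :: real and W :: "'a \<Rightarrow> real" and \<sigma> :: real
  assumes "prob_space M"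
    and "n1 < n2" and "n2 < n3"
    and X_integrable: "\<And>i. i \<ge> 1 \<Longrightarrow> integrable M (X i)"
    and X_mean_zero: "\<And>i. i \<ge> 1 \<Longrightarrow> prob_space.expectation M (X i) = 0"
    and X_square_integrable: "\<And>i. i \<ge> 1 \<Longrightarrow> integrable M (\<lambda>\<omega>. (X i \<omega>)^2)"
    and X_indep: "prob_space.indep_vars M (\<lambda>_. borel) X {1..}"
    and same_distr_1: "\<And>i. i \<in> {1..n1} \<Longrightarrow> distr M borel (X i) = distr M borel (X 1)"
    and same_distr_2: "\<And>i. i \<in> {n1+1..n2} \<Longrightarrow> distr M borel (X i) = distr M borel (X (n1+1))"
    and same_distr_3: "\<And>i. i \<in> {n2+1..n3} \<Longrightarrow> distr M borel (X i) = distr M borel (X (n2+1))"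
    and same_distr_4: "\<And>i. i \<in> {n3+1..} \<Longrightarrow> distr M borel (X i) = distr M borel (X (n3+1))"
    and lam_pos: "lam > 0"
    and N_measurable: "N \<in> measurable M (count_space UNIV)"
    and N_poisson: "distr M (count_space UNIV) N = measure_pmf (poisson_pmf lam)"
    and N_indep_X: "prob_space.indep_set M
          (sets (vimage_algebra (space M) N (count_space UNIV)))
          (sets (vimage_algebra (space M) (\<lambda>\<omega>. \<lambda>i\<in>{1..}. X i \<omega>) (\<Pi>\<^sub>M i\<in>{1..}. (borel :: real measure))))"
    and W_eq: "W = (\<lambda>\<omega>. \<Sum>i=1..N \<omega>. X i \<omega>)"
    and sigma_pos: "\<sigma> > 0"
    and sigma_sq: "\<sigma>^2 = prob_space.variance M W"
  shows "\<sigma>^2 =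
           (\<Sum>i\<in>{1..n1}. prob_space.variance M (X 1) * \<P>(\<omega> in M. i \<le> N \<omega>))
         + (\<Sum>i\<in>{n1+1..n2}. prob_space.variance M (X (n1+1)) * \<P>(\<omega> in M. i \<le> N \<omega>))
         + (\<Sum>i\<in>{n2+1..n3}. prob_space.variance M (X (n2+1)) * \<P>(\<omega> in M. i \<le> N \<omega>))
         + (\<Sum>\<^sub>\<infinity>i\<in>{n3+1..}. prob_space.variance M (X (n3+1)) * \<P>(\<omega> in M. i \<le> N \<omega>))
     \<and> wasserstein_dist (distr M borel (\<lambda>\<omega>. W \<omega> / \<sigma>)) std_normal_distribution
         \<le> ennreal (1 / \<sigma>^3) * (\<Sum>i\<in>{1..n1}. third_moment_term M (X 1) * ennreal (\<P>(\<omega> in M. i \<le> N \<omega>)^2))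
         + ennreal (1 / \<sigma>^3) * (\<Sum>i\<in>{n1+1..n2}. third_moment_term M (X (n1+1)) * ennreal (\<P>(\<omega> in M. i \<le> N \<omega>)^2))
         + ennreal (1 / \<sigma>^3) * (\<Sum>i\<in>{n2+1..n3}. third_moment_term M (X (n2+1)) * ennreal (\<P>(\<omega> in M. i \<le> N \<omega>)^2))
         + ennreal (1 / \<sigma>^3) * (\<Sum>\<^sub>\<infinity>i\<in>{n3+1..}. third_moment_term M (X (n3+1)) * ennreal (\<P>(\<omega> in M. i \<le> N \<omega>)^2))
         + ennreal (2 * sqrt 2 / sqrt pi *
             (1 - (\<Sum>i\<in>{1..n1}. prob_space.variance M (X 1) / \<sigma>^2 * \<P>(\<omega> in M. i \<le> N \<omega>)^2)
             - (\<Sum>i\<in>{n1+1..n2}. prob_space.variance M (X (n1+1)) / \<sigma>^2 * \<P>(\<omega> in M. i \<le> N \<omega>)^2)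
             - (\<Sum>i\<in>{n2+1..n3}. prob_space.variance M (X (n2+1)) / \<sigma>^2 * \<P>(\<omega> in M. i \<le> N \<omega>)^2)
             - (\<Sum>\<^sub>\<infinity>i\<in>{n3+1..}. prob_space.variance M (X (n3+1)) / \<sigma>^2 * \<P>(\<omega> in M. i \<le> N \<omega>)^2)))"
proof -
  interpret prob_space M by fact
  \<comment> \<open>\<open>r i\<close> represents the group of \<open>i\<close>. It takes at most
    four values, so every real quantity determined by the law of \<open>X i\<close> is bounded in
    \<open>i\<close>. At 0 the value is 1, so \<open>r1\<close> holds for all indices.\<close>
  define r where "r i = (if i \<le> n1 then 1 else if i \<le> n2 then n1+1 else if i \<le> n3 then n2+1 else n3+1)" for i
  have r1: "1 \<le> r i" and r_range: "r i \<in> {1, n1+1, n2+1, n3+1}" for i by (auto simp: r_def)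
  have distr_r: "distr M borel (X i) = distr M borel (X (r i))" if "1 \<le> i" for i
    using that same_distr_1[of i] same_distr_2[of i] same_distr_3[of i] same_distr_4[of i]
    by (auto simp: r_def)
  have [measurable]: "X i \<in> borel_measurable M" if "1 \<le> i" for i
    using X_integrable[OF that] by simp
  have nn_r: "(\<integral>\<^sup>+\<omega>. g (X i \<omega>) \<partial>M) = (\<integral>\<^sup>+\<omega>. g (X (r i) \<omega>) \<partial>M)"
    if "1 \<le> i" "g \<in> borel_measurable borel" for i and g :: "real \<Rightarrow> ennreal"
    using arg_cong[OF distr_r[OF that(1)], of "\<lambda>D. nn_integral D g"] that r1 by (simp add: nn_integral_distr)
  have E_r: "expectation (\<lambda>\<omega>. g (X i \<omega>)) = expectation (\<lambda>\<omega>. g (X (r i) \<omega>))"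
    if "1 \<le> i" "g \<in> borel_measurable borel" for i and g :: "real \<Rightarrow> real"
    using arg_cong[OF distr_r[OF that(1)], of "\<lambda>D. integral\<^sup>L D g"] that r1 by (simp add: integral_distr)
  have T_r: "third_moment_term M (X i) = third_moment_term M (X (r i))" if "1 \<le> i" for i
    unfolding third_moment_term_def
    using nn_r[OF that, of "\<lambda>x. ennreal (\<bar>x\<bar> ^ 3)"] E_r[OF that, of "\<lambda>x. x\<^sup>2"] E_r[OF that, of abs]
    by simp
  have V_r: "expectation (\<lambda>\<omega>. (X i \<omega>)\<^sup>2) = expectation (\<lambda>\<omega>. (X (r i) \<omega>)\<^sup>2)" if "1 \<le> i" for i
    using E_r[OF that, of "\<lambda>x. x\<^sup>2"] by simp
  have var: "variance (X i) = expectation (\<lambda>\<omega>. (X i \<omega>)\<^sup>2)" if "1 \<le> i" for i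
    using X_mean_zero[OF that] by simp
  have bounded_r: "\<exists>K\<ge>0. \<forall>i. h (r i) \<le> K" for h :: "nat \<Rightarrow> real"
  proof (intro exI conjI allI)
    let ?H = "insert 0 (h ` {1, n1+1, n2+1, n3+1})"
    show "0 \<le> Max ?H" by (intro Max_ge) auto
    show "h (r i) \<le> Max ?H" for i using r_range[of i] by (intro Max_ge) auto
  qed
  let ?q = "\<lambda>n. \<P>(\<omega> in M. N \<omega> = n)" and ?p = "\<lambda>i. \<P>(\<omega> in M. i \<le> N \<omega>)"
  let ?v = "\<lambda>i. expectation (\<lambda>\<omega>. (X i \<omega>)\<^sup>2)"
  have q: "?q n = lam ^ n / fact n * exp (- lam)" for n
  proof -
    have "?q n = measure (distr M (count_space UNIV) N) {n}"
      using N_measurable by (subst measure_distr) (auto intro!: arg_cong[where f=prob])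
    then show ?thesis
      using lam_pos by (simp add: N_poisson measure_pmf_single)
  qed
  \<comment> \<open>Finiteness of the Poisson mean; with variances bounded by \<open>K\<close>, the
    conditional variance given \<open>N = n\<close> is at most \<open>K * n\<close>.\<close>
  have q_n: "(\<lambda>n. ?q n * (K * real n)) summable_on UNIV" for K
  proof -
    have "(\<lambda>n. ?q n * real n) summable_on UNIV"
      using summable_poisson_mean[of lam] lam_pos
      by (subst summable_on_UNIV_nonneg_real_iff) (auto simp: q)
    from summable_on_cmult_left[OF this, of K] show ?thesis by (simp add: ac_simps)
  qed
  have summ_v: "(\<lambda>n. ?q n * (\<Sum>i=1..n. ?v i)) summable_on UNIV"
  proof -
    obtain K where K: "\<And>i. ?v (r i) \<le> K" using bounded_r[of ?v] by blast
    show ?thesis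
    proof (rule summable_on_comparison_test[OF q_n[of K]])
      fix n
      have "(\<Sum>i=1..n. ?v i) \<le> (\<Sum>i=1..n. K)"
      proof (rule sum_mono)
        fix i assume "i \<in> {1..n}"
        then show "?v i \<le> K" using V_r[of i] K[of i] by simp
      qed
      then show "?q n * (\<Sum>i=1..n. ?v i) \<le> ?q n * (K * real n)"
        by (intro mult_left_mono) (auto simp: mult.commute)
    qed (auto intro!: mult_nonneg_nonneg sum_nonneg)
  qed
  interpret X: random_sum M X N
    by unfold_locales
       (use X_indep X_integrable X_square_integrable X_mean_zero N_measurable N_indep_X summ_v in auto)
  have W: "W = X.W"
    by (simp add: W_eq X.W_def X.S_def fun_eq_iff)
  have split: "infsum f {1..} = sum f {1..n1} + sum f {n1+1..n2} + sum f {n2+1..n3} + infsum f {n3+1..}"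
    if "f summable_on {1..}" for f :: "nat \<Rightarrow> real"
    using \<open>n1 < n2\<close> \<open>n2 < n3\<close> by (intro infsum_split_four summable_on_subset[OF that]) auto
  have r_group: "i \<in> {1..n1} \<Longrightarrow> r i = 1" "i \<in> {n1+1..n2} \<Longrightarrow> r i = n1+1" "i \<in> {n2+1..n3} \<Longrightarrow> r i = n2+1"
      "i \<in> {n3+1..} \<Longrightarrow> r i = n3+1" for i
    using \<open>n1 < n2\<close> \<open>n2 < n3\<close> by (auto simp: r_def)
  have v_group: "i \<in> {1..n1} \<Longrightarrow> ?v i = variance (X 1)" "i \<in> {n1+1..n2} \<Longrightarrow> ?v i = variance (X (n1+1))"
      "i \<in> {n2+1..n3} \<Longrightarrow> ?v i = variance (X (n2+1))" "i \<in> {n3+1..} \<Longrightarrow> ?v i = variance (X (n3+1))" for i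
    using V_r[of i] r_group[of i] by (auto simp: var simp del: One_nat_def)
  have T_group: "i \<in> {1..n1} \<Longrightarrow> third_moment_term M (X i) = third_moment_term M (X 1)"
      "i \<in> {n1+1..n2} \<Longrightarrow> third_moment_term M (X i) = third_moment_term M (X (n1+1))"
      "i \<in> {n2+1..n3} \<Longrightarrow> third_moment_term M (X i) = third_moment_term M (X (n2+1))"
      "i \<in> {n3+1..} \<Longrightarrow> third_moment_term M (X i) = third_moment_term M (X (n3+1))" for i
    using T_r[of i] r_group[of i] by auto
  have var_W: "((\<lambda>i. ?v i * ?p i) has_sum \<sigma>\<^sup>2) {1..}"
    using X.W_variance by (simp add: sigma_sq W)
  \<comment> \<open>Strict positivity matters for infinite third moments: in \<open>ennreal\<close>,
    a zero weight times \<top> would be 0.\<close>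
  have p_pos: "0 < ?p i" for i
  proof -
    have "0 < ?q i" using lam_pos by (simp add: q)
    also have "?q i \<le> ?p i" using N_measurable by (intro finite_measure_mono) auto
    finally show ?thesis .
  qed
  have p_sq_le: "(?p i)\<^sup>2 \<le> ?p i" for i
    using p_pos[of i] by (simp add: power2_eq_square mult_left_le)
  \<comment> \<open>The tails sum to the mean of \<open>N\<close>: the triangle swap with all
    summands equal to 1.\<close>
  have summ_p: "?p summable_on {1..}"
  proof -
    obtain s where s: "((\<lambda>n. ?q n * (\<Sum>i=1..n. 1)) has_sum s) UNIV"
      using q_n[of 1] by (auto simp: summable_on_def)
    from has_sum_triangle_swap[OF _ _ _ _ this, of "\<lambda>_. 1" 1]
    have "((\<lambda>i. \<Sum>\<^sub>\<infinity>n\<in>{i..}. ?q n) has_sum s) {1..}"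
      using q_n[of 1] by simp
    then show ?thesis
      using infsumI[OF X.q_has_sum_p] by (simp add: summable_on_def) blast
  qed
  have summ_p_sq: "(\<lambda>i. h i * (?p i)\<^sup>2) summable_on {1..}"
    if "\<And>i. 1 \<le> i \<Longrightarrow> 0 \<le> h i" "\<And>i. 1 \<le> i \<Longrightarrow> h i = h (r i)" for h :: "nat \<Rightarrow> real"
  proof -
    obtain K where K: "0 \<le> K" "\<And>i. h (r i) \<le> K" using bounded_r[of h] by blast
    show ?thesis
    proof (rule summable_on_comparison_test[OF summable_on_cmult_right[OF summ_p, of K]])
      fix i :: nat assume i: "i \<in> {1..}"
      then show "h i * (?p i)\<^sup>2 \<le> K * ?p i"
        using that[of i] K p_sq_le[of i] by (intro mult_mono) auto
    qed (use that in auto)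
  qed
  have var_formula: "\<sigma>^2 =
           (\<Sum>i\<in>{1..n1}. variance (X 1) * ?p i)
         + (\<Sum>i\<in>{n1+1..n2}. variance (X (n1+1)) * ?p i)
         + (\<Sum>i\<in>{n2+1..n3}. variance (X (n2+1)) * ?p i)
         + (\<Sum>\<^sub>\<infinity>i\<in>{n3+1..}. variance (X (n3+1)) * ?p i)"
    unfolding infsumI[OF var_W, symmetric] split[OF has_sum_imp_summable[OF var_W]]
    by (intro arg_cong2[where f="(+)"] sum.cong infsum_cong) (auto simp only: v_group)
  have v_sq: "(\<Sum>\<^sub>\<infinity>i\<in>{1..}. ?v i / \<sigma>\<^sup>2 * (?p i)\<^sup>2) =
             (\<Sum>i\<in>{1..n1}. variance (X 1) / \<sigma>^2 * (?p i)^2)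
             + (\<Sum>i\<in>{n1+1..n2}. variance (X (n1+1)) / \<sigma>^2 * (?p i)^2)
             + (\<Sum>i\<in>{n2+1..n3}. variance (X (n2+1)) / \<sigma>^2 * (?p i)^2)
             + (\<Sum>\<^sub>\<infinity>i\<in>{n3+1..}. variance (X (n3+1)) / \<sigma>^2 * (?p i)^2)"
  proof -
    have summ: "(\<lambda>i. ?v i / \<sigma>\<^sup>2 * (?p i)\<^sup>2) summable_on {1..}"
      by (rule summ_p_sq) (use V_r in auto)
    show ?thesis
      unfolding split[OF summ]
      by (intro arg_cong2[where f="(+)"] sum.cong infsum_cong) (auto simp only: v_group)
  qed
  have T_sum: "ennreal (1 / \<sigma>^3) * (\<Sum>\<^sub>\<infinity>i\<in>{1..}. third_moment_term M (X i) * ennreal ((?p i)\<^sup>2)) =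
           ennreal (1 / \<sigma>^3) * (\<Sum>i\<in>{1..n1}. third_moment_term M (X 1) * ennreal ((?p i)^2))
         + ennreal (1 / \<sigma>^3) * (\<Sum>i\<in>{n1+1..n2}. third_moment_term M (X (n1+1)) * ennreal ((?p i)^2))
         + ennreal (1 / \<sigma>^3) * (\<Sum>i\<in>{n2+1..n3}. third_moment_term M (X (n2+1)) * ennreal ((?p i)^2))
         + ennreal (1 / \<sigma>^3) * (\<Sum>\<^sub>\<infinity>i\<in>{n3+1..}. third_moment_term M (X (n3+1)) * ennreal ((?p i)^2))"
  proof -
    let ?T = "\<lambda>i. third_moment_term M (X i) * ennreal ((?p i)\<^sup>2)"
    have "infsum ?T {1..} = sum ?T {1..n1} + sum ?T {n1+1..n2} + sum ?T {n2+1..n3} + infsum ?T {n3+1..}"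
      using \<open>n1 < n2\<close> \<open>n2 < n3\<close> by (intro infsum_split_four nonneg_summable_on_complete) auto
    then show ?thesis
      unfolding distrib_left[symmetric]
      by (simp only:, intro arg_cong2[where f="(+)"] arg_cong2[where f="(*)"] refl sum.cong infsum_cong)
         (auto simp only: T_group)
  qed
  have "wasserstein_dist (distr M borel (\<lambda>\<omega>. W \<omega> / \<sigma>)) std_normal_distribution
    \<le> ennreal (1 / \<sigma>^3) * (\<Sum>\<^sub>\<infinity>i\<in>{1..}. third_moment_term M (X i) * ennreal ((?p i)\<^sup>2))
      + ennreal (2 * sqrt 2 / sqrt pi * (1 - (\<Sum>\<^sub>\<infinity>i\<in>{1..}. ?v i / \<sigma>\<^sup>2 * (?p i)\<^sup>2)))"
  \<comment> \<open>If one third moment is infinite, its positive weight and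
    \<open>1 / \<sigma>^3 > 0\<close> make the right side \<top>.\<close>
  proof (cases "\<forall>i\<ge>1. integrable M (\<lambda>\<omega>. \<bar>X i \<omega>\<bar> ^ 3)")
    case False
    then obtain i where i: "1 \<le> i" "\<not> integrable M (\<lambda>\<omega>. \<bar>X i \<omega>\<bar> ^ 3)" by blast
    then have "(\<integral>\<^sup>+\<omega>. ennreal (\<bar>X i \<omega>\<bar> ^ 3) \<partial>M) = \<top>"
      by (auto simp: integrable_iff_bounded less_top[symmetric])
    then have "third_moment_term M (X i) * ennreal ((?p i)\<^sup>2) = \<top>"
      using p_pos[of i] by (simp add: third_moment_term_def ennreal_top_mult)
    then have "(\<Sum>\<^sub>\<infinity>i\<in>{1..}. third_moment_term M (X i) * ennreal ((?p i)\<^sup>2)) = \<top>"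
      using ennreal_le_infsum[of i "{1..}" "\<lambda>i. third_moment_term M (X i) * ennreal ((?p i)\<^sup>2)"] i
      by (simp add: top_unique)
    then show ?thesis using sigma_pos by (simp add: ennreal_mult_top)
  next
    case True
    have T: "third_moment_term M (X i) = ennreal (X.third_moment i)" if "1 \<le> i" for i
      using True that
      by (simp add: third_moment_term_def X.third_moment_def nn_integral_eq_integral ennreal_plus[symmetric] del: ennreal_plus)
    have tau_nonneg: "0 \<le> X.third_moment i" for i
      by (simp add: X.third_moment_def)
    have tau_r: "X.third_moment i = X.third_moment (r i)" if "1 \<le> i" for i
      unfolding X.third_moment_def
      using E_r[OF that, of "\<lambda>x. \<bar>x\<bar> ^ 3"] E_r[OF that, of "\<lambda>x. x\<^sup>2"] E_r[OF that, of abs] by simp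
    have summ_tau: "(\<lambda>i. X.third_moment i * (?p i)\<^sup>2) summable_on {1..}"
      by (rule summ_p_sq) (use tau_nonneg tau_r in auto)
    \<comment> \<open>The general bound is for unit variance, so it is applied to the normalized
      summands.\<close>
    interpret Y: random_sum M "\<lambda>i \<omega>. X i \<omega> / \<sigma>" N
    proof unfold_locales
      show "indep_vars (\<lambda>_. borel) (\<lambda>i \<omega>. X i \<omega> / \<sigma>) {1..}"
        by (rule indep_vars_compose2[OF X_indep]) simp
      show "(\<lambda>n. ?q n * (\<Sum>i = 1..n. expectation (\<lambda>\<omega>. (X i \<omega> / \<sigma>)\<^sup>2))) summable_on UNIV"
        using summable_on_cmult_left[OF summ_v, of "1 / \<sigma>\<^sup>2"]
        by (simp add: power_divide sum_divide_distrib[symmetric])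
      show "indep_set (sets (vimage_algebra (space M) N (count_space UNIV)))
        (sets (vimage_algebra (space M) (\<lambda>\<omega>. \<lambda>i\<in>{1..}. X i \<omega> / \<sigma>) (\<Pi>\<^sub>M i\<in>{1..}. borel)))"
      \<comment> \<open>Division by \<sigma> in each coordinate is measurable, so the scaled
        sequence generates a sub-\<sigma>-algebra of the original one.\<close>
      proof -
        let ?X = "\<lambda>\<omega>. \<lambda>i\<in>{1..}. X i \<omega>" and ?Y = "\<lambda>\<omega>. \<lambda>i\<in>{1..}. X i \<omega> / \<sigma>"
        let ?P = "\<Pi>\<^sub>M i\<in>{1..}. (borel :: real measure)"
        let ?V = "vimage_algebra (space M) ?X ?P"
        have "?X \<in> measurable ?V ?P"
          by (rule measurable_vimage_algebra1) (auto simp: space_PiM)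
        moreover have "(\<lambda>x. \<lambda>i\<in>{1..}. x i / \<sigma>) \<in> measurable ?P ?P"
          by (intro measurable_restrict borel_measurable_divide measurable_component_singleton) auto
        ultimately have "(\<lambda>\<omega>. \<lambda>i\<in>{1..}. ?X \<omega> i / \<sigma>) \<in> measurable ?V ?P"
          by (rule measurable_compose)
        also have "(\<lambda>\<omega>. \<lambda>i\<in>{1..}. ?X \<omega> i / \<sigma>) = ?Y"
          by (auto simp: fun_eq_iff)
        finally have "sets (vimage_algebra (space M) ?Y ?P) \<subseteq> sets ?V"
          by (rule sets_image_in_sets[OF space_vimage_algebra])
        then show ?thesis
          using N_indep_X unfolding indep_sets2_eq by blast
      qed
    qed (use X_integrable X_square_integrable X_mean_zero N_measurable in \<open>auto simp: power_divide\<close>)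
    have YW: "Y.W = (\<lambda>\<omega>. W \<omega> / \<sigma>)"
      by (simp add: Y.W_def Y.S_def W_eq fun_eq_iff sum_divide_distrib)
    \<comment> \<open>Both summands of \<open>third_moment\<close> are homogeneous of degree three
      in the variable.\<close>
    have Y_tau: "Y.third_moment i = 1 / \<sigma>^3 * X.third_moment i" for i
      using sigma_pos
      by (simp add: Y.third_moment_def X.third_moment_def power_divide abs_divide add_divide_distrib power3_eq_cube power2_eq_square)
    have "variance Y.W = 1"
    proof -
      have "variance Y.W = variance W / \<sigma>\<^sup>2"
        by (simp add: YW power_divide diff_divide_distrib[symmetric])
      then show ?thesis using sigma_pos by (simp add: sigma_sq[symmetric])
    qed
    then have "wasserstein_dist (distr M borel Y.W) std_normal_distribution
      \<le> ennreal ((\<Sum>\<^sub>\<infinity>i\<in>{1..}. Y.third_moment i * (?p i)\<^sup>2)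
        + 4 / sqrt (2 * pi) * (1 - (\<Sum>\<^sub>\<infinity>i\<in>{1..}. expectation (\<lambda>\<omega>. (X i \<omega> / \<sigma>)\<^sup>2) * (?p i)\<^sup>2)))"
    proof (rule Y.wasserstein_dist_W_le)
      show "integrable M (\<lambda>\<omega>. \<bar>X i \<omega> / \<sigma>\<bar> ^ 3)" if "1 \<le> i" for i
        using True that by (simp add: power_divide abs_divide)
      show "(\<lambda>i. Y.third_moment i * (?p i)\<^sup>2) summable_on {1..}"
        using summable_on_cmult_right[OF summ_tau, of "1 / \<sigma>^3"] by (simp add: Y_tau)
    qed
    also have "(\<Sum>\<^sub>\<infinity>i\<in>{1..}. Y.third_moment i * (?p i)\<^sup>2) = 1 / \<sigma>^3 * (\<Sum>\<^sub>\<infinity>i\<in>{1..}. X.third_moment i * (?p i)\<^sup>2)"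
      unfolding Y_tau mult.assoc by (rule infsum_cmult_right')
    also have "4 / sqrt (2 * pi) = 2 * sqrt 2 / sqrt pi"
      by (simp add: real_sqrt_mult field_simps)
    also have "(\<Sum>\<^sub>\<infinity>i\<in>{1..}. expectation (\<lambda>\<omega>. (X i \<omega> / \<sigma>)\<^sup>2) * (?p i)\<^sup>2) = (\<Sum>\<^sub>\<infinity>i\<in>{1..}. ?v i / \<sigma>\<^sup>2 * (?p i)\<^sup>2)"
      by (simp add: power_divide)
    also have "ennreal (1 / \<sigma>^3 * (\<Sum>\<^sub>\<infinity>i\<in>{1..}. X.third_moment i * (?p i)\<^sup>2)
        + 2 * sqrt 2 / sqrt pi * (1 - (\<Sum>\<^sub>\<infinity>i\<in>{1..}. ?v i / \<sigma>\<^sup>2 * (?p i)\<^sup>2)))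
      \<le> ennreal (1 / \<sigma>^3 * (\<Sum>\<^sub>\<infinity>i\<in>{1..}. X.third_moment i * (?p i)\<^sup>2))
        + ennreal (2 * sqrt 2 / sqrt pi * (1 - (\<Sum>\<^sub>\<infinity>i\<in>{1..}. ?v i / \<sigma>\<^sup>2 * (?p i)\<^sup>2)))"
      using sigma_pos tau_nonneg by (intro ennreal_add_le mult_nonneg_nonneg infsum_nonneg) auto
    also have "ennreal (1 / \<sigma>^3 * (\<Sum>\<^sub>\<infinity>i\<in>{1..}. X.third_moment i * (?p i)\<^sup>2))
      = ennreal (1 / \<sigma>^3) * (\<Sum>\<^sub>\<infinity>i\<in>{1..}. ennreal (X.third_moment i * (?p i)\<^sup>2))"
      using sigma_pos tau_nonneg
      by (subst infsum_ennreal_eq[OF summ_tau]; (intro ennreal_mult infsum_nonneg)?) auto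
    also have "(\<Sum>\<^sub>\<infinity>i\<in>{1..}. ennreal (X.third_moment i * (?p i)\<^sup>2))
      = (\<Sum>\<^sub>\<infinity>i\<in>{1..}. third_moment_term M (X i) * ennreal ((?p i)\<^sup>2))"
      by (rule infsum_cong) (simp add: T ennreal_mult tau_nonneg)
    finally show ?thesis by (simp only: YW)
  qed
  then show ?thesis
    using var_formula unfolding T_sum v_sq by (simp only: diff_diff_eq)
qed

end
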